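(* Let $k$ be a real number with $0<k\le 1$, let $N\ge 4$ and $1\le m\le N-3$ be integers, and let $\rho_{AB_1\cdots B_{N-1}}$ be an $N$-qubit mixed state. Suppose that $k\,\mathcal{N}_{cAB_i}^2\ge \mathcal{N}_{cA|B_{i+1}\cdots B_{N-1}}^2$ for $i=1,2,\ldots,m$, and $\mathcal{N}_{cAB_j}^2\le k\,\mathcal{N}_{cA|B_{j+1}\cdots B_{N-1}}^2$ for $j=m+1,\ldots,N-2$. Then for all real $\beta\ge 4$, $$ \mathcal{N}^{\beta}_{cA|B_1\cdots B_{N-1}} \ \ge\ \mathcal{N}^{\beta}_{cAB_1}+\sum_{i=1}^{m-1}\Big(\prod_{j=1}^{i}\mathcal{P}_j\Big)\mathcal{N}^{\beta}_{cAB_{i+1}}+\Big(\prod_{i=1}^{m}\mathcal{P}_i\Big)\Big(\sum_{j=m+1}^{N-2}\mathcal{R}_j\,\mathcal{N}^{\beta}_{cAB_j}+\mathcal{N}^{\beta}_{cAB_{N-1}}\Big), $$ where $M=\frac{(1+k)^{\beta/2}-1}{k^{\beta/2}}+k^{\beta/2}$, $\mathcal{P}_i=M-\frac{\mathcal{N}^{\beta}_{cA|B_{i+1}\cdots B_{N-1}}}{\mathcal{N}^{\beta}_{cAB_i}}$ for $i=1,\ldots,m$, and $\mathcal{R}_j=M-\frac{\mathcal{N}^{\beta}_{cAB_j}}{\mathcal{N}^{\beta}_{cA|B_{j+1}\cdots B_{N-1}}}$ for $j=m+1,\ldots,N-2$.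
   Context: A state is a density matrix (positive semidefinite, trace one) on the finite-dimensional Hilbert space $H_A\otimes H_{B_1}\otimes\cdots\otimes H_{B_{N-1}}$; in the $N$-qubit case every factor is $\mathbb{C}^2$. The negativity of a bipartite state $\rho_{XY}$ is normalized here as $\mathcal{N}(\rho_{XY})=\|\rho_{XY}^{T_X}\|-1$, where $T_X$ is the partial transpose on $X$ and $\|Z\|=\mathrm{tr}\sqrt{ZZ^\dagger}$ is the trace norm; for a pure state $|\psi\rangle_{XY}$ this equals $(\mathrm{tr}\sqrt{\rho_X})^2-1$ with $\rho_X=\mathrm{tr}_Y|\psi\rangle\langle\psi|$. The convex-roof extended negativity (CREN) of a bipartite mixed state is $\mathcal{N}_c(\rho_{XY})=\min\sum_i p_i\,\mathcal{N}(|\psi_i\rangle)$, the minimum being over all finite pure state decompositions $\rho_{XY}=\sum_i p_i|\psi_i\rangle\langle\psi_i|$ with $p_i\ge0$, $\sum_i p_i=1$. $\mathcal{N}_{cAB_i}$ is the CREN of the two-qubit reduced density matrix $\rho_{AB_i}$ of the given state. $\mathcal{N}_{cA|B_i\cdots B_{N-1}}$ is the CREN of the reduced density matrix on $A,B_i,\ldots,B_{N-1}$, viewed as a bipartite state under the bipartition $A$ versus $B_i\cdots B_{N-1}$; in particular $\mathcal{N}_{cA|B_{N-1}}=\mathcal{N}_{cAB_{N-1}}$. $\mathcal{N}^\beta_{c\,\cdot}$ means $(\mathcal{N}_{c\,\cdot})^\beta$. Convention: if a denominator in a ratio vanishes then, by the hypotheses, the numerator vanishes too, and the ratio $0/0$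 is read as $0$. *)

theory Defs
  imports "Jordan_Normal_Form.Schur_Decomposition"
begin

text \<open>
  Operators on a finite-dimensional Hilbert space are square complex matrices with respect to an
  orthonormal basis. A tensor product $H_1 \otimes H_2$ of spaces of dimensions $d_1$, $d_2$ has
  the product basis in Kronecker order: the pair $(x, y)$ has index $x d_2 + y$. Hence an
  $N$-qubit operator is a $2^N \times 2^N$ matrix, the most significant binary digit of an index
  belonging to the first factor.
\<close>

definition mat_trace :: "complex mat \<Rightarrow> complex" where
  "mat_trace A = (\<Sum>i<dim_row A. A $$ (i, i))"

text \<open>The order on \<^typ>\<open>complex\<close> makes \<open>0 \<le> z\<close> mean that \<open>z\<close> is real and nonnegative.\<close>

definition psd :: "nat \<Rightarrow> complex mat \<Rightarrow> bool" where
  "psd d A \<longleftrightarrow> A \<in> carrier_mat d d \<and> (\<forall>v \<in> carrier_vec d. 0 \<le> (A *\<^sub>v v) \<bullet>c v)"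

definition density_matrix :: "nat \<Rightarrow> complex mat \<Rightarrow> bool" where
  "density_matrix d \<rho> \<longleftrightarrow> psd d \<rho> \<and> mat_trace \<rho> = 1"

text \<open>Meaningful only for positive semidefinite arguments, where the square root is unique.\<close>

definition psd_sqrt :: "complex mat \<Rightarrow> complex mat" where
  "psd_sqrt A = (THE S. psd (dim_row A) S \<and> S * S = A)"

definition trace_norm :: "complex mat \<Rightarrow> real" where
  "trace_norm Z = Re (mat_trace (psd_sqrt (Z * mat_adjoint Z)))"

text \<open>Transposition of the first factor of a space with factors of dimensions \<open>dX\<close> and \<open>dY\<close>:
  the entry at row $(x, y)$ and column $(x', y')$ is $\rho_{(x', y), (x, y')}$.\<close>

definition partial_transpose :: "nat \<Rightarrow> nat \<Rightarrow> complex mat \<Rightarrow> complex mat" where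
  "partial_transpose dX dY \<rho> = mat (dX * dY) (dX * dY) (\<lambda>(r, c).
     \<rho> $$ ((c div dY) * dY + r mod dY, (r div dY) * dY + c mod dY))"

text \<open>The middle one of three factors of dimensions \<open>dA\<close>, \<open>dB\<close>, \<open>dC\<close> is traced out. Taking
  \<open>dC = 1\<close> traces out the last factor.\<close>

definition partial_trace :: "nat \<Rightarrow> nat \<Rightarrow> nat \<Rightarrow> complex mat \<Rightarrow> complex mat" where
  "partial_trace dA dB dC \<rho> = mat (dA * dC) (dA * dC) (\<lambda>(r, c).
     \<Sum>b<dB. \<rho> $$ ((r div dC) * (dB * dC) + b * dC + r mod dC,
                   (c div dC) * (dB * dC) + b * dC + c mod dC))"

definition negativity :: "nat \<Rightarrow> nat \<Rightarrow> complex mat \<Rightarrow> real" where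
  "negativity dX dY \<rho> = trace_norm (partial_transpose dX dY \<rho>) - 1"

definition pure_state :: "nat \<Rightarrow> complex vec \<Rightarrow> bool" where
  "pure_state d \<psi> \<longleftrightarrow> \<psi> \<in> carrier_vec d \<and> \<psi> \<bullet>c \<psi> = 1"

definition projector :: "complex vec \<Rightarrow> complex mat" where
  "projector \<psi> = mat (dim_vec \<psi>) (dim_vec \<psi>) (\<lambda>(r, c). \<psi> $ r * cnj (\<psi> $ c))"

definition pure_decomposition ::
  "nat \<Rightarrow> complex mat \<Rightarrow> nat \<Rightarrow> (nat \<Rightarrow> real) \<Rightarrow> (nat \<Rightarrow> complex vec) \<Rightarrow> bool" where
  "pure_decomposition d \<rho> n p \<psi> \<longleftrightarrow>
     (\<forall>i<n. 0 \<le> p i \<and> pure_state d (\<psi> i)) \<and> (\<Sum>i<n. p i) = 1 \<and>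
     \<rho> = mat d d (\<lambda>(r, c). \<Sum>i<n. of_real (p i) * projector (\<psi> i) $$ (r, c))"

text \<open>The minimum in the convex roof is written as \<^const>\<open>Inf\<close>; the two agree because the
  minimum is attained (Caratheodory's theorem and compactness).\<close>

definition cren :: "nat \<Rightarrow> nat \<Rightarrow> complex mat \<Rightarrow> real" where
  "cren dX dY \<rho> = Inf {\<Sum>i<n. p i * negativity dX dY (projector (\<psi> i)) | n p \<psi>.
     pure_decomposition (dX * dY) \<rho> n p \<psi>}"

text \<open>The reduced density matrix on \<open>A, B\<^sub>i, \<dots>, B\<^sub>j\<close> of an \<open>N\<close>-qubit state on
  \<open>A, B\<^sub>1, \<dots>, B\<^sub>N\<^sub>-\<^sub>1\<close>, for \<open>1 \<le> i \<le> j \<le> N - 1\<close>: first \<open>B\<^sub>1, \<dots>, B\<^sub>i\<^sub>-\<^sub>1\<close> are traced out,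
  then \<open>B\<^sub>j\<^sub>+\<^sub>1, \<dots>, B\<^sub>N\<^sub>-\<^sub>1\<close>.\<close>

definition reduced_state :: "nat \<Rightarrow> complex mat \<Rightarrow> nat \<Rightarrow> nat \<Rightarrow> complex mat" where
  "reduced_state N \<rho> i j =
     partial_trace (2 * 2 ^ (j + 1 - i)) (2 ^ (N - 1 - j)) 1
       (partial_trace 2 (2 ^ (i - 1)) (2 ^ (N - i)) \<rho>)"

definition cren_pair :: "nat \<Rightarrow> complex mat \<Rightarrow> nat \<Rightarrow> real" where
  "cren_pair N \<rho> i = cren 2 2 (reduced_state N \<rho> i i)"

definition cren_tail :: "nat \<Rightarrow> complex mat \<Rightarrow> nat \<Rightarrow> real" where
  "cren_tail N \<rho> i = cren 2 (2 ^ (N - i)) (reduced_state N \<rho> i (N - 1))"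

definition coeff_M :: "real \<Rightarrow> real \<Rightarrow> real" where
  "coeff_M k \<beta> = ((1 + k) powr (\<beta> / 2) - 1) / k powr (\<beta> / 2) + k powr (\<beta> / 2)"

text \<open>Division by zero yields \<open>0\<close>, so the ratio \<open>0 / 0\<close> is read as \<open>0\<close> in the next two
  definitions.\<close>

definition coeff_P :: "real \<Rightarrow> real \<Rightarrow> nat \<Rightarrow> complex mat \<Rightarrow> nat \<Rightarrow> real" where
  "coeff_P k \<beta> N \<rho> i =
     coeff_M k \<beta> - cren_tail N \<rho> (i + 1) powr \<beta> / cren_pair N \<rho> i powr \<beta>"

definition coeff_R :: "real \<Rightarrow> real \<Rightarrow> nat \<Rightarrow> complex mat \<Rightarrow> nat \<Rightarrow> real" where
  "coeff_R k \<beta> N \<rho> j =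
     coeff_M k \<beta> - cren_pair N \<rho> j powr \<beta> / cren_tail N \<rho> (j + 1) powr \<beta>"

end

theory Submission
  imports "HOL-Analysis.Function_Topology" "HOL-Analysis.Topology_Euclidean_Space" "HOL-Analysis.Convex" Defs
begin

text \<open>
  Everything rests on the monogamy relation
  $N_{A|BC}^2 \ge N_{AB}^2 + N_{A|C}^2$ for qubits $A$, $B$ and arbitrary finite-dimensional $C$;
  the weighted powers then follow from the fact that $((1+s)^a - 1)/s^a + s^a$ decreases in
  $s \in (0,1]$ for $a \ge 2$.

  As $A$ is a qubit, the negativity of a pure state equals its concurrence
  $2\sqrt{\det \rho_A}$, so mixed states reduce to pure ones by the triangle inequality in the
  plane. For a pure state it suffices to exhibit one decomposition of $\rho_{AB}$ and one of
  $\rho_{AC}$. Slice the state along $C$ into $2 \times 2$ matrices $w_c$, and let $g$ maximise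
  $|\det|$ among the superpositions $\sum_c x_c w_c$ with $\sum_c |x_c|^2 \le 1$. Filtering $A$ by
  $g^{-1}$ multiplies all terms of the inequality by the same factor, so one may take $g = 1$;
  maximality then makes $\rho_{AB}$ the sum of the projector on $g$ and a part supported on
  traceless matrices. A unitary on $B$ makes $\sum_c w_c^\dagger w_c$ diagonal, and then an explicit
  ensemble for $AB$, together with measuring $B$ in a suitable basis
  $(1, \pm t)/\sqrt{2}$ for $AC$, gives the claim.
\<close>

subsection \<open>Power inequalities\<close>

text \<open>Maximality of the determinant is used twice. To first order it says that the half traces
  of the filtered slices are the conjugates of the optimal coefficients, so every superposition
  orthogonal to the optimal one is traceless. Tested again on one particular traceless
  superposition, it bounds that determinant by 1, and this makes the determinants in the
  \<open>AB\<close> ensemble nonnegative, so that their moduli add up without loss. The phase t of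
  the measurement on \<open>B\<close> is then chosen so that the bound on the \<open>AC\<close> side
  reaches the same number. Filtering needs an invertible maximiser. If the largest determinant is 0,
  all slices are singular and the slices themselves form an \<open>AB\<close> ensemble of
  concurrence 0. For mixed states the right-hand roof is bounded below ensemble by ensemble: the
  witnesses belonging to the single vectors are glued into one ensemble for each reduced
  state.\<close>

lemma power_ratio_antimono:
  fixes a s k :: real
  assumes a: "2 \<le> a" and s: "0 < s" "s \<le> k" and k: "k \<le> 1"
  shows "((1 + k) powr a - 1) / k powr a + k powr a \<le> ((1 + s) powr a - 1) / s powr a + s powr a"
proof -
  define f where "f x = ((1 + x) powr a - 1) / x powr a + x powr a" for x :: real
  define f' where "f' x = ((a * (1 + x) powr (a - 1)) * x powr a - ((1 + x) powr a - 1) * (a * x powr (a - 1)))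
      / (x powr a * x powr a) + a * x powr (a - 1)" for x :: real
  have "f k \<le> f s"
  proof (rule DERIV_nonpos_imp_nonincreasing[OF s(2)])
    fix x assume x: "s \<le> x" "x \<le> k"
    have x0: "0 < x" "x \<le> 1" using x s k by auto
    have "(f has_real_derivative f' x) (at x)"
      unfolding f_def f'_def using x0
      by (auto intro!: derivative_eq_intros simp: powr_diff field_simps)
    moreover have "f' x \<le> 0"
    proof -
      have e1: "(1 + x) powr a = (1 + x) powr (a - 1) * (1 + x)"
        using powr_add[of "1 + x" "a - 1" 1] x0 by simp
      have e2: "x powr a = x powr (a - 1) * x"
        using powr_add[of "x" "a - 1" 1] x0 by simp
      have p: "x powr (a - 1) > 0" using x0 by simp
      \<comment> \<open>The sign of the derivative rests on this bound, and it is where the exponent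
        condition (\<open>a\<close> at least 2) enters: x^(2a) is at most x, and (1 + x)^(a - 1) is
        at least 1 + x.\<close>
      have ge: "1 + x powr a * x powr a \<le> (1 + x) powr (a - 1)"
      proof -
        have "x powr a \<le> x powr 1" by (rule powr_mono') (use x0 a in auto)
        then have "x powr a \<le> x" using x0 by simp
        then have "x powr a * x powr a \<le> x * 1" using x0 by (intro mult_mono) auto
        moreover have "(1 + x) powr 1 \<le> (1 + x) powr (a - 1)" by (rule powr_mono) (use x0 a in auto)
        ultimately show ?thesis using x0 by simp
      qed
      have "f' x = a * x powr (a - 1) * (1 - (1 + x) powr (a - 1) + x powr a * x powr a) / (x powr a * x powr a)"
        unfolding f'_def using p x0 by (simp add: e1 e2 field_simps)
      also have "\<dots> \<le> 0"
        using ge p a by (intro divide_nonpos_nonneg mult_nonneg_nonpos) auto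
      finally show ?thesis .
    qed
    ultimately show "\<exists>y. (f has_real_derivative y) (at x) \<and> y \<le> 0" by blast
  qed
  then show ?thesis by (simp add: f_def)
qed

text \<open>Put a = b / 2 and s = t^2 / p^2, so s is at most k. Replacing k by s in the first two
  terms of \<open>c\<close> can only increase it, to ((1 + s)^a - 1) / s^a. As t^b = s^a p^b, the
  left side is at most (1 + s)^a p^b = (p^2 + t^2)^a. In the application \<open>p\<close> is the
  dominant term: the pair in front, the tail in the rear.\<close>

lemma monogamy_power_step:
  fixes k b p t u :: real
  assumes k: "0 < k" "k \<le> 1" and b: "4 \<le> b"
    and nn: "0 \<le> p" "0 \<le> t" "0 \<le> u"
    and mono: "p\<^sup>2 + t\<^sup>2 \<le> u\<^sup>2" and le: "t\<^sup>2 \<le> k * p\<^sup>2"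
  defines "c \<equiv> ((1 + k) powr (b / 2) - 1) / k powr (b / 2) + k powr (b / 2) - t powr b / p powr b"
  shows "0 \<le> c" and "p powr b + c * t powr b \<le> u powr b"
proof -
  define a where "a = b / 2"
  have a: "2 \<le> a" using b by (simp add: a_def)
  have M: "0 \<le> ((1 + k) powr a - 1) / k powr a"
    using k a by (intro divide_nonneg_nonneg) (auto simp: ge_one_powr_ge_zero)
  have sq: "x powr b = (x\<^sup>2) powr a" if "0 \<le> x" for x :: real
    using that by (cases "x = 0") (simp_all add: a_def powr_powr flip: powr_numeral)
  show "0 \<le> c"
  \<comment> \<open>Division by zero removes the ratio from \<open>c\<close> and leaves a
    nonnegative constant.\<close>
  proof (cases "p = 0")
    case True
    then show ?thesis using M by (simp add: c_def a_def[symmetric])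
  next
    case False
    then have p: "0 < p" using nn by simp
    have "t powr b \<le> k powr a * p powr b"
      unfolding sq[OF nn(1)] sq[OF nn(2)] using le k a
      by (metis powr_mono2 powr_mult zero_le_power2 order.trans zero_le_numeral less_imp_le)
    then have "t powr b / p powr b \<le> k powr a" using p by (simp add: divide_le_eq)
    then show ?thesis using M by (simp add: c_def a_def[symmetric])
  qed
  show "p powr b + c * t powr b \<le> u powr b"
  proof (cases "t = 0")
    case True
    then have "p powr b \<le> u powr b"
      unfolding sq[OF nn(1)] sq[OF nn(3)] using mono a by (intro powr_mono2) auto
    then show ?thesis using True by simp
  next
    case False
    then have t: "0 < t" using nn by simp
    then have "0 < k * p\<^sup>2" using le by (meson less_le_trans zero_less_power)
    then have p: "0 < p" using nn k by (cases "p = 0") auto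
    define s where "s = t\<^sup>2 / p\<^sup>2"
    have s: "0 < s" "s \<le> k" using t p le by (auto simp: s_def divide_le_eq)
    define P where "P = p powr b"
    define S where "S = s powr a"
    have P: "0 < P" and S: "0 < S" using p s by (auto simp: P_def S_def)
    have ts: "t\<^sup>2 = s * p\<^sup>2" using p by (simp add: s_def)
    have tS: "t powr b = S * P"
      unfolding S_def P_def sq[OF nn(1)] sq[OF nn(2)] ts using s by (simp add: powr_mult)
    have "c = ((1 + k) powr a - 1) / k powr a + k powr a - S"
      using P by (simp add: c_def a_def[symmetric] tS P_def[symmetric])
    also have "\<dots> \<le> ((1 + s) powr a - 1) / S"
      using power_ratio_antimono[OF a s k(2)] by (simp add: S_def)
    finally have "c * (S * P) \<le> ((1 + s) powr a - 1) / S * (S * P)"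
      using P S by (intro mult_right_mono) auto
    also have "\<dots> = (1 + s) powr a * P - P" using S by (simp add: field_simps)
    also have "(1 + s) powr a * P = (p\<^sup>2 + t\<^sup>2) powr a"
      unfolding P_def sq[OF nn(1)] ts using s by (simp add: powr_mult[symmetric] algebra_simps)
    also have "\<dots> \<le> u powr b"
      unfolding sq[OF nn(3)] using mono a by (intro powr_mono2) auto
    finally show ?thesis by (simp add: tS P_def[symmetric])
  qed
qed

text \<open>\<open>p\<close> stands for the pairs, \<open>t\<close> for the tails, \<open>L\<close>
  for N - 1. In front the coefficient multiplies the tail, so unrolling the tail accumulates
  products of \<open>P\<close>. In the rear the pair is the smaller term and carries
  \<open>R\<close>; the next tail passes on with weight 1 and no product builds up.\<close>

lemma monogamy_power_chain:
  fixes p t :: "nat \<Rightarrow> real" and k b :: real and L m :: nat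
  assumes k: "0 < k" "k \<le> 1" and b: "4 \<le> b"
    and m: "1 \<le> m" "m < L"
    and nn: "\<And>i. 1 \<le> i \<Longrightarrow> i \<le> L \<Longrightarrow> 0 \<le> p i \<and> 0 \<le> t i"
    and mono: "\<And>i. 1 \<le> i \<Longrightarrow> i < L \<Longrightarrow> (p i)\<^sup>2 + (t (i + 1))\<^sup>2 \<le> (t i)\<^sup>2"
    and last: "t L = p L"
    and front: "\<And>i. i \<in> {1..m} \<Longrightarrow> (t (i + 1))\<^sup>2 \<le> k * (p i)\<^sup>2"
    and rear: "\<And>j. j \<in> {m+1..L-1} \<Longrightarrow> (p j)\<^sup>2 \<le> k * (t (j + 1))\<^sup>2"
    and P: "\<And>i. P i = ((1 + k) powr (b / 2) - 1) / k powr (b / 2) + k powr (b / 2)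
      - t (i + 1) powr b / p i powr b"
    and R: "\<And>i. R i = ((1 + k) powr (b / 2) - 1) / k powr (b / 2) + k powr (b / 2)
      - p i powr b / t (i + 1) powr b"
  shows "p 1 powr b + (\<Sum>i=1..m-1. (\<Prod>j=1..i. P j) * p (i + 1) powr b)
     + (\<Prod>i=1..m. P i) * ((\<Sum>j=m+1..L-1. R j * p j powr b) + p L powr b) \<le> t 1 powr b"
proof -
  have P0: "0 \<le> P i" and P1: "p i powr b + P i * t (i + 1) powr b \<le> t i powr b" if "i \<in> {1..m}" for i
    using monogamy_power_step[OF k b _ _ _ mono front, of i] nn[of i] nn[of "i + 1"] that m
    unfolding P by auto
  have R1: "t (j + 1) powr b + R j * p j powr b \<le> t j powr b" if "j \<in> {m+1..L-1}" for j
    using monogamy_power_step(2)[OF k b _ _ _ _ rear, of j "t j"] mono[of j] nn[of j] nn[of "j + 1"] that m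
    unfolding R by (auto simp: add.commute)
  \<comment> \<open>Downward from \<open>L\<close>, where the tail is the last pair.\<close>
  have tail: "(\<Sum>j=i..L-1. R j * p j powr b) + p L powr b \<le> t i powr b"
    if "m + 1 \<le> i" "i \<le> L" for i
    using that(2,1)
  proof (induction rule: inc_induct)
    case base
    then show ?case using m last by simp
  next
    case (step i)
    have "(\<Sum>j=i..L-1. R j * p j powr b) = R i * p i powr b + (\<Sum>j=Suc i..L-1. R j * p j powr b)"
      using step by (intro sum.atLeast_Suc_atMost) auto
    moreover have "t (i + 1) powr b + R i * p i powr b \<le> t i powr b" using step by (intro R1) auto
    ultimately show ?case using step by simp
  qed
  have "n \<le> m \<Longrightarrow> 1 \<le> n \<Longrightarrow> p 1 powr b + (\<Sum>i=1..n-1. (\<Prod>j=1..i. P j) * p (i + 1) powr b)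
     + (\<Prod>i=1..n. P i) * t (n + 1) powr b \<le> t 1 powr b" for n
  proof (induction n)
    case 0
    then show ?case by simp
  next
    case (Suc n)
    show ?case
    proof (cases "n = 0")
      case True
      then show ?thesis using P1[of 1] Suc by simp
    next
      case False
      have s: "(\<Sum>i=1..n. (\<Prod>j=1..i. P j) * p (i + 1) powr b)
          = (\<Sum>i=1..n-1. (\<Prod>j=1..i. P j) * p (i + 1) powr b) + (\<Prod>j=1..n. P j) * p (n + 1) powr b"
        using False by (cases n) simp_all
      have "0 \<le> (\<Prod>i=1..n. P i)" using P0 Suc by (intro prod_nonneg) auto
      then have "(\<Prod>i=1..n. P i) * (p (n + 1) powr b + P (n + 1) * t (n + 2) powr b)
          \<le> (\<Prod>i=1..n. P i) * t (n + 1) powr b"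
        using P1[of "n + 1"] Suc by (intro mult_left_mono) auto
      then show ?thesis using Suc False s by (simp add: algebra_simps)
    qed
  qed
  from this[of m] have "p 1 powr b + (\<Sum>i=1..m-1. (\<Prod>j=1..i. P j) * p (i + 1) powr b)
     + (\<Prod>i=1..m. P i) * t (m + 1) powr b \<le> t 1 powr b" using m by simp
  moreover have "(\<Prod>i=1..m. P i) * ((\<Sum>j=m+1..L-1. R j * p j powr b) + p L powr b)
      \<le> (\<Prod>i=1..m. P i) * t (m + 1) powr b"
    using P0 m tail[of "m + 1"] by (intro mult_left_mono prod_nonneg) auto
  ultimately show ?thesis by linarith
qed

subsection \<open>Two-by-two matrices\<close>

lemma sum_lessThan_2: "(\<Sum>i<2. f i) = f 0 + f (1::nat)"
  by (simp add: numeral_2_eq_2)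

lemma Suc_numerals: "Suc (Suc 0) = 2" "Suc (Suc (Suc 0)) = 3"
  by simp_all

lemma sum_lessThan_2_times: "(\<Sum>i\<in>{..<2::nat} \<times> A. f i) = (\<Sum>c\<in>A. f (0, c) + f (1, c))"
proof -
  have "(\<Sum>i\<in>{..<2::nat} \<times> A. f i) = (\<Sum>b<2::nat. \<Sum>c\<in>A. f (b, c))"
    by (simp add: sum.cartesian_product)
  then show ?thesis by (simp add: sum_lessThan_2 sum.distrib)
qed

lemma sum_lessThan_4: "(\<Sum>i<4. f i) = f 0 + f 1 + f 2 + f (3::nat)"
  by (simp add: eval_nat_numeral)

lemma all_less_4: "(\<forall>r<4. P r) \<longleftrightarrow> P 0 \<and> P 1 \<and> P 2 \<and> P (3::nat)"
  by (auto simp: eval_nat_numeral less_Suc_eq)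

lemma all_less_2: "(\<forall>r<2. P r) \<longleftrightarrow> P 0 \<and> P (1::nat)"
  by (auto simp: eval_nat_numeral less_Suc_eq)

lemma of_real_cmod_sq: "complex_of_real ((cmod z)\<^sup>2) = z * cnj z"
  by (rule complex_norm_square)

text \<open>The determinant of the 2x2 Gram matrix. For the two blocks of a pure state that belong
  to the basis vectors of the qubit \<open>A\<close>, it is the determinant of the reduced state of
  \<open>A\<close>.\<close>

definition gram_det :: "'i set \<Rightarrow> ('i \<Rightarrow> complex) \<Rightarrow> ('i \<Rightarrow> complex) \<Rightarrow> real" where
  "gram_det I f g = (\<Sum>i\<in>I. (cmod (f i))\<^sup>2) * (\<Sum>i\<in>I. (cmod (g i))\<^sup>2) - (cmod (\<Sum>i\<in>I. f i * cnj (g i)))\<^sup>2"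

lemma gram_det_nonneg: "0 \<le> gram_det I f g"
proof -
  have "(cmod (\<Sum>i\<in>I. f i * cnj (g i)))\<^sup>2 \<le> (\<Sum>i\<in>I. cmod (f i) * cmod (g i))\<^sup>2"
    by (intro power_mono order.trans[OF norm_sum]) (auto simp: norm_mult)
  also have "\<dots> \<le> (\<Sum>i\<in>I. (cmod (f i))\<^sup>2) * (\<Sum>i\<in>I. (cmod (g i))\<^sup>2)"
    by (rule Cauchy_Schwarz_ineq_sum)
  finally show ?thesis by (simp add: gram_det_def)
qed

lemma of_real_gram_det:
  "complex_of_real (gram_det I f g) = (\<Sum>i\<in>I. f i * cnj (f i)) * (\<Sum>i\<in>I. g i * cnj (g i))
     - (\<Sum>i\<in>I. f i * cnj (g i)) * (\<Sum>i\<in>I. g i * cnj (f i))"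
proof -
  have c: "(\<Sum>i\<in>I. g i * cnj (f i)) = cnj (\<Sum>i\<in>I. f i * cnj (g i))" by (simp add: mult.commute)
  show ?thesis
    unfolding c gram_det_def of_real_diff of_real_mult of_real_sum of_real_cmod_sq ..
qed

text \<open>Mixing two vectors by a matrix T turns their Gram matrix G into T G T^dagger. A filter
  on \<open>A\<close> acts in this way.\<close>

lemma gram_det_linear:
  "gram_det I (\<lambda>i. a * f i + b * g i) (\<lambda>i. c * f i + d * g i) = (cmod (a * d - b * c))\<^sup>2 * gram_det I f g"
proof -
  have e: "(\<Sum>i\<in>I. (a * f i + b * g i) * cnj (c * f i + d * g i)) =
     a * cnj c * (\<Sum>i\<in>I. f i * cnj (f i)) + a * cnj d * (\<Sum>i\<in>I. f i * cnj (g i))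
     + b * cnj c * (\<Sum>i\<in>I. g i * cnj (f i)) + b * cnj d * (\<Sum>i\<in>I. g i * cnj (g i))" for a b c d
    by (simp add: sum_distrib_left sum.distrib algebra_simps)
  have "complex_of_real (gram_det I (\<lambda>i. a * f i + b * g i) (\<lambda>i. c * f i + d * g i)) =
     complex_of_real ((cmod (a * d - b * c))\<^sup>2 * gram_det I f g)"
    unfolding of_real_mult of_real_cmod_sq of_real_gram_det e by (simp add: algebra_simps)
  then show ?thesis by (simp only: of_real_eq_iff)
qed

text \<open>The second equation says that the $(0, 1)$ entry of $V^\dagger H V$ vanishes, where $H$ has
  rows $(a, b)$ and $(\bar b, d)$ and the unitary $V$ has rows $(p, -\bar q)$ and $(q, \bar p)$.\<close>

lemma hermitian_2x2_diagonalize: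
  fixes a d :: real and b :: complex
  shows "\<exists>p q. p * cnj p + q * cnj q = 1 \<and>
    b * cnj p * cnj p - cnj b * cnj q * cnj q + of_real (d - a) * cnj p * cnj q = 0"
proof (cases "b = 0")
  case True
  then show ?thesis by (intro exI[of _ 1] exI[of _ 0]) simp
next
  case False
  \<comment> \<open>The vector (b, l) is an eigenvector of H for the larger eigenvalue (a + d + s) /
    2, and l is that eigenvalue minus a. It is nonzero because b is; \<open>n\<close> is its
    length.\<close>
  define s where "s = sqrt ((a - d)\<^sup>2 + 4 * (cmod b)\<^sup>2)"
  define l where "l = (d - a + s) / 2"
  have s2: "s\<^sup>2 = (a - d)\<^sup>2 + 4 * (cmod b)\<^sup>2" unfolding s_def by simp
  have l: "l * l = (cmod b)\<^sup>2 + (d - a) * l"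
    using s2 by (simp add: l_def power2_eq_square field_simps)
  define n where "n = sqrt ((cmod b)\<^sup>2 + l\<^sup>2)"
  have n0: "n \<noteq> 0" and n2: "n * n = (cmod b)\<^sup>2 + l * l"
    using False by (auto simp: n_def power2_eq_square add_nonneg_eq_0_iff)
  have nn: "complex_of_real n * complex_of_real n = b * cnj b + complex_of_real l * complex_of_real l"
    unfolding of_real_cmod_sq[symmetric] of_real_mult[symmetric] of_real_add[symmetric] n2 ..
  have ll: "complex_of_real l * complex_of_real l = b * cnj b + complex_of_real (d - a) * complex_of_real l"
    unfolding of_real_cmod_sq[symmetric] of_real_mult[symmetric] of_real_add[symmetric] l ..
  show ?thesis
  proof (intro exI conjI)
    show "b / of_real n * cnj (b / of_real n) + of_real l / of_real n * cnj (of_real l / of_real n) = 1"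
    proof -
      have "complex_of_real n * complex_of_real n \<noteq> 0" using n0 by simp
      then show ?thesis by (simp add: add_divide_distrib[symmetric] nn[symmetric])
    qed
    have "b * cnj b * cnj b - cnj b * of_real l * of_real l + of_real (d - a) * cnj b * of_real l
        = cnj b * (b * cnj b + of_real (d - a) * of_real l - of_real l * of_real l)"
      by (simp add: algebra_simps)
    also have "\<dots> = 0" by (simp only: ll) simp
    finally have e: "b * cnj b * cnj b - cnj b * of_real l * of_real l + of_real (d - a) * cnj b * of_real l = 0" .
    have "b * cnj (b / of_real n) * cnj (b / of_real n) - cnj b * cnj (of_real l / of_real n) * cnj (of_real l / of_real n)
        + of_real (d - a) * cnj (b / of_real n) * cnj (of_real l / of_real n)
       = (b * cnj b * cnj b - cnj b * of_real l * of_real l + of_real (d - a) * cnj b * of_real l) / (of_real n * of_real n)"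
      by (simp add: add_divide_distrib diff_divide_distrib)
    then show "b * cnj (b / of_real n) * cnj (b / of_real n) - cnj b * cnj (of_real l / of_real n) * cnj (of_real l / of_real n)
        + of_real (d - a) * cnj (b / of_real n) * cnj (of_real l / of_real n) = 0"
      unfolding e by simp
  qed
qed

text \<open>A $2 \times 2$ matrix is a function on $\{0,1,2,3\}$ with its $(a, b)$ entry at $2a + b$.\<close>

definition det2 :: "(nat \<Rightarrow> complex) \<Rightarrow> complex" where
  "det2 w = w 0 * w 3 - w 1 * w 2"

definition mult2 :: "(nat \<Rightarrow> complex) \<Rightarrow> (nat \<Rightarrow> complex) \<Rightarrow> nat \<Rightarrow> complex" where
  "mult2 a b r = a (2 * (r div 2)) * b (r mod 2) + a (2 * (r div 2) + 1) * b (2 + r mod 2)"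

lemma mult2_simps:
  "mult2 a b 0 = a 0 * b 0 + a 1 * b 2"
  "mult2 a b (Suc 0) = a 0 * b 1 + a 1 * b 3"
  "mult2 a b 2 = a 2 * b 0 + a 3 * b 2"
  "mult2 a b 3 = a 2 * b 1 + a 3 * b 3"
proof -
  have "2 + Suc 0 = 3" by simp
  then show "mult2 a b (Suc 0) = a 0 * b 1 + a 1 * b 3" by (simp add: mult2_def)
qed (simp_all add: mult2_def)

definition one2 :: "nat \<Rightarrow> complex" where
  "one2 r = (if r = 0 \<or> r = 3 then 1 else 0)"

lemma mult2_assoc: "mult2 (mult2 a b) c = mult2 a (mult2 b c)"
  by (auto simp: mult2_def fun_eq_iff algebra_simps)

lemma mult2_cong: "(\<And>r. r < 4 \<Longrightarrow> b r = b' r) \<Longrightarrow> mult2 a b = mult2 a b'"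
  by (auto simp: mult2_def fun_eq_iff)

lemma mult2_one_left: "(\<And>r. r < 4 \<Longrightarrow> k r = one2 r) \<Longrightarrow> r < 4 \<Longrightarrow> mult2 k a r = a r"
  using all_less_4[of "\<lambda>r. mult2 k a r = a r"] by (simp add: mult2_simps one2_def)

lemma mult2_one_right: "(\<And>r. r < 4 \<Longrightarrow> k r = one2 r) \<Longrightarrow> mult2 a k r = a r"
proof (cases "even r")
  case False
  then have "Suc (2 * (r div 2)) = r" "r mod 2 = Suc 0" by (simp_all add: odd_iff_mod_2_eq_one)
  moreover assume "\<And>r. r < 4 \<Longrightarrow> k r = one2 r"
  ultimately show ?thesis by (simp add: mult2_def one2_def Suc_numerals)
qed (auto simp: mult2_def one2_def)

lemma det2_mult2: "det2 (mult2 a b) = det2 a * det2 b"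
  by (simp add: det2_def mult2_simps algebra_simps)

text \<open>Here \<open>w c\<close> are the slices along $C$ of a pure state, \<open>e\<close> is a decomposition of
  $\rho_{AB}$, and \<open>u\<close> is the basis in which $B$ is measured to decompose $\rho_{AC}$. The
  inequality is the monogamy relation divided by 4.\<close>

definition pure_monogamy :: "nat \<Rightarrow> (nat \<Rightarrow> nat \<Rightarrow> complex) \<Rightarrow> bool" where
  "pure_monogamy d w \<longleftrightarrow> (\<exists>(n::nat) e (u :: nat \<Rightarrow> nat \<Rightarrow> complex).
     (\<forall>r<4. \<forall>s<4. (\<Sum>j<n. e j r * cnj (e j s)) = (\<Sum>c<d. w c r * cnj (w c s))) \<and>
     (\<forall>a<2. \<forall>b<2. (\<Sum>j<2::nat. u j a * cnj (u j b)) = (if a = b then 1 else 0)) \<and>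
     (\<Sum>j<n. cmod (det2 (e j)))\<^sup>2
     + (\<Sum>j<2. sqrt (gram_det {..<d} (\<lambda>c. u j 0 * w c 0 + u j 1 * w c 1) (\<lambda>c. u j 0 * w c 2 + u j 1 * w c 3)))\<^sup>2
     \<le> gram_det ({..<2::nat} \<times> {..<d}) (\<lambda>(b, c). w c b) (\<lambda>(b, c). w c (2 + b)))"

section \<open>Transport of the pure-state inequality along local operations\<close>

lemma gram_transform:
  fixes e :: "'j \<Rightarrow> nat \<Rightarrow> complex"
  assumes "\<forall>r<4. \<forall>s<4. (\<Sum>j\<in>J. e j r * cnj (e j s)) = (\<Sum>c\<in>C. w c r * cnj (w c s))"
  shows "(\<Sum>j\<in>J. (\<Sum>a<4. k a * e j a) * cnj (\<Sum>b<4. l b * e j b))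
    = (\<Sum>c\<in>C. (\<Sum>a<4. k a * w c a) * cnj (\<Sum>b<4. l b * w c b))"
proof -
  have *: "(\<Sum>j\<in>J. (\<Sum>a<4. k a * e j a) * cnj (\<Sum>b<4. l b * e j b))
     = (\<Sum>a<4. \<Sum>b<4. k a * cnj (l b) * (\<Sum>j\<in>J. e j a * cnj (e j b)))" for J :: "'x set" and e
  proof -
    have "(\<Sum>j\<in>J. (\<Sum>a<4. k a * e j a) * cnj (\<Sum>b<4. l b * e j b))
       = (\<Sum>j\<in>J. \<Sum>a<4. \<Sum>b<4. k a * cnj (l b) * (e j a * cnj (e j b)))"
      by (simp add: sum_product mult_ac)
    also have "\<dots> = (\<Sum>a<4. \<Sum>b<4. \<Sum>j\<in>J. k a * cnj (l b) * (e j a * cnj (e j b)))"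
      by (subst sum.swap, rule sum.cong[OF refl], rule sum.swap)
    finally show ?thesis by (simp add: sum_distrib_left)
  qed
  show ?thesis unfolding * using assms by (intro sum.cong refl) auto
qed

text \<open>The map sending e to g e v is linear in the four entries, and Gram sums see a family
  only through its operator. So two ensembles of one operator remain so after local
  operations.\<close>

lemma gram_mult2:
  assumes "\<forall>r<4. \<forall>s<4. (\<Sum>j\<in>J. e j r * cnj (e j s)) = (\<Sum>c\<in>C. w c r * cnj (w c s))"
  shows "\<forall>r<4. \<forall>s<4. (\<Sum>j\<in>J. mult2 g (mult2 (e j) v) r * cnj (mult2 g (mult2 (e j) v) s))
    = (\<Sum>c\<in>C. mult2 g (mult2 (w c) v) r * cnj (mult2 g (mult2 (w c) v) s))"
proof -
  have *: "mult2 g (mult2 e v) r = (\<Sum>a<4. (g (2 * (r div 2) + a div 2) * v (2 * (a mod 2) + r mod 2)) * e a)"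
    if "r < 4" for r and e :: "nat \<Rightarrow> complex"
  proof -
    from that have "r = 0 \<or> r = 1 \<or> r = 2 \<or> r = 3" by auto
    then show ?thesis
      by (elim disjE) (simp_all add: sum_lessThan_4 mult2_simps, simp_all add: algebra_simps eval_nat_numeral)
  qed
  show ?thesis
    by (intro allI impI) (simp only: * gram_transform[OF assms])
qed

text \<open>The witnesses are the filtered ensemble and the unchanged basis \<open>u\<close>. Each
  \<open>det2\<close> gains the factor det g and each Gram determinant |det g|^2, so all three terms
  scale by |det g|^2.\<close>

lemma pure_monogamy_left:
  assumes "pure_monogamy d z"
  shows "pure_monogamy d (\<lambda>c. mult2 g (z c))"
proof -
  from assms obtain n :: nat and e and u :: "nat \<Rightarrow> nat \<Rightarrow> complex" where
    gram: "\<forall>r<4. \<forall>s<4. (\<Sum>j<n. e j r * cnj (e j s)) = (\<Sum>c<d. z c r * cnj (z c s))" and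
    u: "\<forall>a<2. \<forall>b<2. (\<Sum>j<2::nat. u j a * cnj (u j b)) = (if a = b then 1 else 0)" and
    le: "(\<Sum>j<n. cmod (det2 (e j)))\<^sup>2
     + (\<Sum>j<2. sqrt (gram_det {..<d} (\<lambda>c. u j 0 * z c 0 + u j 1 * z c 1) (\<lambda>c. u j 0 * z c 2 + u j 1 * z c 3)))\<^sup>2
     \<le> gram_det ({..<2::nat} \<times> {..<d}) (\<lambda>(b, c). z c b) (\<lambda>(b, c). z c (2 + b))"
    unfolding pure_monogamy_def by blast
  have one: "mult2 a one2 = a" for a by (rule ext) (rule mult2_one_right, rule refl)
  let ?D = "cmod (det2 g)"
  have 1: "gram_det {..<d} (\<lambda>c. u j 0 * mult2 g (z c) 0 + u j 1 * mult2 g (z c) 1)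
      (\<lambda>c. u j 0 * mult2 g (z c) 2 + u j 1 * mult2 g (z c) 3)
    = ?D\<^sup>2 * gram_det {..<d} (\<lambda>c. u j 0 * z c 0 + u j 1 * z c 1) (\<lambda>c. u j 0 * z c 2 + u j 1 * z c 3)" for j
    unfolding det2_def gram_det_linear[symmetric] by (simp add: mult2_simps algebra_simps)
  have 2: "gram_det ({..<2::nat} \<times> {..<d}) (\<lambda>(b, c). mult2 g (z c) b) (\<lambda>(b, c). mult2 g (z c) (2 + b))
    = ?D\<^sup>2 * gram_det ({..<2::nat} \<times> {..<d}) (\<lambda>(b, c). z c b) (\<lambda>(b, c). z c (2 + b))"
  proof -
    have "gram_det ({..<2::nat} \<times> {..<d}) (\<lambda>(b, c). mult2 g (z c) b) (\<lambda>(b, c). mult2 g (z c) (2 + b))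
      = gram_det ({..<2::nat} \<times> {..<d}) (\<lambda>i. g 0 * (case i of (b, c) \<Rightarrow> z c b) + g 1 * (case i of (b, c) \<Rightarrow> z c (2 + b)))
         (\<lambda>i. g 2 * (case i of (b, c) \<Rightarrow> z c b) + g 3 * (case i of (b, c) \<Rightarrow> z c (2 + b)))"
      unfolding gram_det_def
      by (intro arg_cong2[of _ _ _ _ minus] arg_cong2[of _ _ _ _ times] arg_cong[of _ _ "\<lambda>x. (cmod x)\<^sup>2"] sum.cong refl)
        (auto simp: less_2_cases_iff mult2_simps Suc_numerals)
    then show ?thesis unfolding gram_det_linear by (simp add: det2_def)
  qed
  have "\<forall>r<4. \<forall>s<4. (\<Sum>j<n. mult2 g (e j) r * cnj (mult2 g (e j) s))
    = (\<Sum>c<d. mult2 g (z c) r * cnj (mult2 g (z c) s))"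
    using gram_mult2[OF gram, of g one2] by (simp add: one)
  moreover have "(\<Sum>j<n. cmod (det2 (mult2 g (e j))))\<^sup>2
     + (\<Sum>j<2. sqrt (gram_det {..<d} (\<lambda>c. u j 0 * mult2 g (z c) 0 + u j 1 * mult2 g (z c) 1)
         (\<lambda>c. u j 0 * mult2 g (z c) 2 + u j 1 * mult2 g (z c) 3)))\<^sup>2
     \<le> gram_det ({..<2::nat} \<times> {..<d}) (\<lambda>(b, c). mult2 g (z c) b) (\<lambda>(b, c). mult2 g (z c) (2 + b))"
    using mult_left_mono[OF le, of "?D\<^sup>2"]
    unfolding 1 2 det2_mult2 norm_mult real_sqrt_mult sum_distrib_left[symmetric]
    by (simp add: power_mult_distrib distrib_left)
  ultimately show ?thesis unfolding pure_monogamy_def using u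
    by (intro exI[of _ n] exI[of _ "\<lambda>j. mult2 g (e j)"] exI[of _ u] conjI)
qed

text \<open>A unitary on \<open>B\<close> changes neither the reduced state of \<open>A\<close> nor
  the moduli of the determinants. Only the measurement basis has to be rotated with it.\<close>

lemma pure_monogamy_right:
  assumes "pure_monogamy d z"
    and v: "v 0 * cnj (v 0) + v 1 * cnj (v 1) = 1" "v 2 * cnj (v 2) + v 3 * cnj (v 3) = 1"
      "v 0 * cnj (v 2) + v 1 * cnj (v 3) = 0"
      "cnj (v 0) * v 0 + cnj (v 2) * v 2 = 1" "cnj (v 1) * v 1 + cnj (v 3) * v 3 = 1"
      "cnj (v 0) * v 1 + cnj (v 2) * v 3 = 0"
    and dv: "cmod (det2 v) = 1"
  shows "pure_monogamy d (\<lambda>c. mult2 (z c) v)"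
proof -
  from assms(1) obtain n :: nat and e and u :: "nat \<Rightarrow> nat \<Rightarrow> complex" where
    gram: "\<forall>r<4. \<forall>s<4. (\<Sum>j<n. e j r * cnj (e j s)) = (\<Sum>c<d. z c r * cnj (z c s))" and
    u: "\<forall>a<2. \<forall>b<2. (\<Sum>j<2::nat. u j a * cnj (u j b)) = (if a = b then 1 else 0)" and
    le: "(\<Sum>j<n. cmod (det2 (e j)))\<^sup>2
     + (\<Sum>j<2. sqrt (gram_det {..<d} (\<lambda>c. u j 0 * z c 0 + u j 1 * z c 1) (\<lambda>c. u j 0 * z c 2 + u j 1 * z c 3)))\<^sup>2
     \<le> gram_det ({..<2::nat} \<times> {..<d}) (\<lambda>(b, c). z c b) (\<lambda>(b, c). z c (2 + b))"
    unfolding pure_monogamy_def by blast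
  have v3: "v 2 * cnj (v 0) + v 3 * cnj (v 1) = 0" "cnj (v 1) * v 0 + cnj (v 3) * v 2 = 0"
    using v(3,6)[THEN arg_cong[of _ _ cnj]] by (simp_all add: mult.commute)
  \<comment> \<open>\<open>u\<close> times the entrywise conjugate of \<open>v\<close>. By
    \<open>uu\<close>, its outcomes on the rotated state are the outcomes of \<open>u\<close> on the
    original one.\<close>
  define u' where "u' j b = u j 0 * cnj (v b) + u j 1 * cnj (v (2 + b))" for j b :: nat
  have uu: "u' j 0 * (x * v 0 + y * v 2) + u' j 1 * (x * v 1 + y * v 3) = u j 0 * x + u j 1 * y" for j x y
  proof -
    have "u' j 0 * (x * v 0 + y * v 2) + u' j 1 * (x * v 1 + y * v 3) =
      u j 0 * x * (v 0 * cnj (v 0) + v 1 * cnj (v 1)) + u j 0 * y * (v 2 * cnj (v 0) + v 3 * cnj (v 1))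
      + u j 1 * x * (v 0 * cnj (v 2) + v 1 * cnj (v 3)) + u j 1 * y * (v 2 * cnj (v 2) + v 3 * cnj (v 3))"
      by (simp add: u'_def Suc_numerals algebra_simps)
    then show ?thesis unfolding v v3 by simp
  qed
  have u1: "u 0 a * cnj (u 0 b) + u 1 a * cnj (u 1 b) = (if a = b then 1 else 0)" if "a < 2" "b < 2" for a b
    using u that by (simp add: sum_lessThan_2)
  have u'u: "(\<Sum>j<2. u' j a * cnj (u' j b)) = cnj (v a) * v b + cnj (v (2 + a)) * v (2 + b)" for a b
  proof -
    have "(\<Sum>j<2. u' j a * cnj (u' j b)) =
      cnj (v a) * v b * (u 0 0 * cnj (u 0 0) + u 1 0 * cnj (u 1 0))
      + cnj (v a) * v (2 + b) * (u 0 0 * cnj (u 0 1) + u 1 0 * cnj (u 1 1))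
      + cnj (v (2 + a)) * v b * (u 0 1 * cnj (u 0 0) + u 1 1 * cnj (u 1 0))
      + cnj (v (2 + a)) * v (2 + b) * (u 0 1 * cnj (u 0 1) + u 1 1 * cnj (u 1 1))"
      unfolding sum_lessThan_2 by (simp add: u'_def algebra_simps)
    then show ?thesis by (simp add: u1 del: One_nat_def)
  qed
  have u': "\<forall>a<2. \<forall>b<2. (\<Sum>j<2. u' j a * cnj (u' j b)) = (if a = b then 1 else 0)"
    unfolding u'u all_less_2 using v v3 by (simp add: Suc_numerals)
  have gr: "(\<Sum>i\<in>{..<2::nat} \<times> {..<d}. (case i of (b, c) \<Rightarrow> mult2 (z c) v (k + b)) * cnj (case i of (b, c) \<Rightarrow> mult2 (z c) v (l + b)))
     = (\<Sum>i\<in>{..<2::nat} \<times> {..<d}. (case i of (b, c) \<Rightarrow> z c (k + b)) * cnj (case i of (b, c) \<Rightarrow> z c (l + b)))"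
    if kl: "k = 0 \<or> k = 2" "l = 0 \<or> l = 2" for k l
  proof -
    have q: "mult2 (z c) v k = z c k * v 0 + z c (k + 1) * v 2" "mult2 (z c) v (k + 1) = z c k * v 1 + z c (k + 1) * v 3"
      if "k = 0 \<or> k = 2" for k c
      using that by (auto simp: mult2_simps Suc_numerals)
    have "mult2 (z c) v k * cnj (mult2 (z c) v l) + mult2 (z c) v (k + 1) * cnj (mult2 (z c) v (l + 1))
       = z c k * cnj (z c l) + z c (k + 1) * cnj (z c (l + 1))" for c
    proof -
      have "mult2 (z c) v k * cnj (mult2 (z c) v l) + mult2 (z c) v (k + 1) * cnj (mult2 (z c) v (l + 1)) =
        z c k * cnj (z c l) * (v 0 * cnj (v 0) + v 1 * cnj (v 1))
        + z c k * cnj (z c (l + 1)) * (v 0 * cnj (v 2) + v 1 * cnj (v 3))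
        + z c (k + 1) * cnj (z c l) * (v 2 * cnj (v 0) + v 3 * cnj (v 1))
        + z c (k + 1) * cnj (z c (l + 1)) * (v 2 * cnj (v 2) + v 3 * cnj (v 3))"
        unfolding q[OF kl(1)] q[OF kl(2)] by (simp add: algebra_simps)
      then show ?thesis unfolding v v3 by simp
    qed
    then show ?thesis
      by (simp add: sum_lessThan_2_times)
  qed
  have 2: "gram_det ({..<2::nat} \<times> {..<d}) (\<lambda>(b, c). mult2 (z c) v b) (\<lambda>(b, c). mult2 (z c) v (2 + b))
    = gram_det ({..<2::nat} \<times> {..<d}) (\<lambda>(b, c). z c b) (\<lambda>(b, c). z c (2 + b))"
  proof -
    have "complex_of_real (gram_det ({..<2::nat} \<times> {..<d}) (\<lambda>(b, c). mult2 (z c) v b) (\<lambda>(b, c). mult2 (z c) v (2 + b)))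
      = complex_of_real (gram_det ({..<2::nat} \<times> {..<d}) (\<lambda>(b, c). z c b) (\<lambda>(b, c). z c (2 + b)))"
      unfolding of_real_gram_det using gr[of 0 0] gr[of 0 2] gr[of 2 0] gr[of 2 2] by simp
    then show ?thesis by (simp only: of_real_eq_iff)
  qed
  have "\<forall>r<4. \<forall>s<4. (\<Sum>j<n. mult2 (e j) v r * cnj (mult2 (e j) v s))
    = (\<Sum>c<d. mult2 (z c) v r * cnj (mult2 (z c) v s))"
    using gram_mult2[OF gram, of one2 v] by (simp add: mult2_one_left)
  moreover have "(\<Sum>j<n. cmod (det2 (mult2 (e j) v)))\<^sup>2
     + (\<Sum>j<2. sqrt (gram_det {..<d} (\<lambda>c. u' j 0 * mult2 (z c) v 0 + u' j 1 * mult2 (z c) v 1)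
         (\<lambda>c. u' j 0 * mult2 (z c) v 2 + u' j 1 * mult2 (z c) v 3)))\<^sup>2
     \<le> gram_det ({..<2::nat} \<times> {..<d}) (\<lambda>(b, c). mult2 (z c) v b) (\<lambda>(b, c). mult2 (z c) v (2 + b))"
    using le unfolding 2 det2_mult2 norm_mult dv
    by (simp add: mult2_simps uu[simplified])
  ultimately show ?thesis unfolding pure_monogamy_def using u'
    by (intro exI[of _ n] exI[of _ "\<lambda>j. mult2 (e j) v"] exI[of _ u'] conjI)
qed

text \<open>For $\Delta = m_+ - m_-$, where $m_\pm$ are the unnormalised states of $A$ after the
  outcomes $(1, \pm t)/\sqrt 2$, one has
  $2(\det m_+ + \det m_-) = \det(m_+ + m_-) + \det \Delta$. The second assumption makes $\Delta$
  traceless, so $-\det \Delta \ge |\Delta_{01}|^2$, which the third one compares with the $AB$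
  ensemble.\<close>

lemma pure_monogamyI:
  fixes e z :: "nat \<Rightarrow> nat \<Rightarrow> complex"
  assumes gram: "\<forall>r<4. \<forall>s<4. (\<Sum>j<n. e j r * cnj (e j s)) = (\<Sum>c<d. z c r * cnj (z c s))"
    and off: "(\<Sum>c<d. cnj (z c 0) * z c 1 + cnj (z c 2) * z c 3) = 0"
    and t: "t * cnj t = 1"
    and le: "(\<Sum>j<n. cmod (det2 (e j)))
      \<le> cmod (\<Sum>c<d. z c 0 * cnj t * cnj (z c 3) + z c 1 * t * cnj (z c 2))"
  shows "pure_monogamy d z"
proof -
  define a where "a = complex_of_real (1 / sqrt 2)"
  have ca: "cnj a = a" by (simp add: a_def)
  have aa: "a * a = 1 / 2" unfolding a_def of_real_mult[symmetric] by simp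
  define u where "u j b = (if b = 0 then a else if j = 0 then a * t else - (a * t))" for j b :: nat
  define S where "S r s = (\<Sum>c<d. z c r * cnj (z c s))" for r s
  have cS: "cnj (S r s) = S s r" for r s by (simp add: S_def mult.commute)
  \<comment> \<open>The rows of Delta are (p, k) and (cnj k, -p), the last entry by the fact
    \<open>r\<close>. \<open>P\<close>, \<open>Q\<close>, \<open>R\<close> further down are the
    entries of the sum of the two outcome states.\<close>
  define p where "p = cnj t * S 0 1 + t * S 1 0"
  define k where "k = cnj t * S 0 3 + t * S 1 2"
  have cp: "cnj p = p" by (simp add: p_def cS)
  have ck: "cnj k = cnj t * S 2 1 + t * S 3 0" by (simp add: k_def cS add.commute)
  have offS: "S 1 0 + S 3 2 = 0" using off by (simp add: S_def sum.distrib mult.commute)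
  have offS': "S 0 1 + S 2 3 = 0" using arg_cong[OF offS, of cnj] by (simp add: cS)
  have r: "cnj t * S 2 3 + t * S 3 2 = - p"
  proof -
    have "cnj t * S 2 3 + t * S 3 2 + p = cnj t * (S 0 1 + S 2 3) + t * (S 1 0 + S 3 2)"
      by (simp add: p_def algebra_simps)
    then show ?thesis unfolding offS offS' by (simp add: eq_neg_iff_add_eq_0)
  qed
  have att: "a * t * (a * cnj t) = 1 / 2"
  proof -
    have "a * t * (a * cnj t) = (a * a) * (t * cnj t)" by (simp only: mult_ac)
    then show ?thesis by (simp only: aa t) simp
  qed
  define \<epsilon> where "\<epsilon> j = (if j = 0 then 1 else - 1 :: complex)" for j :: nat
  have uc: "u j 0 * cnj (u j 0) = 1 / 2" "u j 1 * cnj (u j 1) = 1 / 2"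
    "u j 0 * cnj (u j 1) = \<epsilon> j * cnj t / 2" "u j 1 * cnj (u j 0) = \<epsilon> j * t / 2" for j
  proof -
    have "a * (cnj a * cnj t) = (a * a) * cnj t" "a * t * cnj a = (a * a) * t" by (simp_all add: ca)
    then have "a * (cnj a * cnj t) = cnj t / 2" "a * t * cnj a = t / 2" by (simp_all only: aa) simp_all
    then show "u j 0 * cnj (u j 0) = 1 / 2" "u j 0 * cnj (u j 1) = \<epsilon> j * cnj t / 2"
      "u j 1 * cnj (u j 0) = \<epsilon> j * t / 2"
      by (simp_all add: u_def ca aa \<epsilon>_def)
    show "u j 1 * cnj (u j 1) = 1 / 2" using att by (simp add: u_def ca)
  qed
  have u: "\<forall>a<2. \<forall>b<2. (\<Sum>j<2::nat. u j a * cnj (u j b)) = (if a = b then 1 else 0)"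
    unfolding all_less_2 sum_lessThan_2 uc by (simp add: \<epsilon>_def)
  let ?g = "\<lambda>j. gram_det {..<d} (\<lambda>c. u j 0 * z c 0 + u j 1 * z c 1) (\<lambda>c. u j 0 * z c 2 + u j 1 * z c 3)"
  have sc: "(\<Sum>c<d. (x * z c r + y * z c s) * cnj (x * z c r' + y * z c s')) =
      x * cnj x * S r r' + x * cnj y * S r s' + y * cnj x * S s r' + y * cnj y * S s s'" for x y r s r' s'
    by (simp add: S_def sum_distrib_left sum.distrib algebra_simps)
  define P where "P = S 0 0 + S 1 1"
  define R where "R = S 2 2 + S 3 3"
  define Q where "Q = S 0 2 + S 1 3"
  have cQ: "cnj Q = S 2 0 + S 3 1" by (simp add: Q_def cS)
  have sgn: "(\<Sum>c<d. (u j 0 * z c r + u j 1 * z c s) * cnj (u j 0 * z c r' + u j 1 * z c s')) =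
      (S r r' + S s s' + \<epsilon> j * (cnj t * S r s' + t * S s r')) / 2" for j r s r' s'
    unfolding sc uc by (simp add: field_simps)
  have g0: "of_real (?g 0) = ((P + p) * (R - p) - (Q + k) * (cnj Q + cnj k)) / 4"
    unfolding of_real_gram_det sgn
    by (simp only: r P_def[symmetric] Q_def[symmetric] R_def[symmetric] p_def[symmetric] k_def[symmetric]
        cQ[symmetric] ck[symmetric]) (simp add: \<epsilon>_def field_simps)
  have g1: "of_real (?g 1) = ((P - p) * (R + p) - (Q - k) * (cnj Q - cnj k)) / 4"
    unfolding of_real_gram_det sgn
    by (simp only: r P_def[symmetric] Q_def[symmetric] R_def[symmetric] p_def[symmetric] k_def[symmetric]
        cQ[symmetric] ck[symmetric]) (simp add: \<epsilon>_def field_simps)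
  let ?G = "gram_det ({..<2::nat} \<times> {..<d}) (\<lambda>(b, c). z c b) (\<lambda>(b, c). z c (2 + b))"
  have G: "of_real ?G = P * R - Q * cnj Q"
    unfolding of_real_gram_det sum_lessThan_2_times cQ
    by (simp add: P_def Q_def R_def S_def sum.distrib Suc_numerals)
  have "complex_of_real (2 * ?g 0 + 2 * ?g 1) = complex_of_real (?G - (cmod p)\<^sup>2 - (cmod k)\<^sup>2)"
    unfolding of_real_diff of_real_cmod_sq G of_real_add of_real_mult g0 g1 cp
    by (simp add: field_simps)
  then have "2 * ?g 0 + 2 * ?g 1 = ?G - (cmod p)\<^sup>2 - (cmod k)\<^sup>2" by (simp only: of_real_eq_iff)
  moreover have "(sqrt (?g 0) + sqrt (?g 1))\<^sup>2 \<le> 2 * ?g 0 + 2 * ?g 1"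
  proof -
    have "0 \<le> (sqrt (?g 0) - sqrt (?g 1))\<^sup>2" by simp
    moreover have "(sqrt (?g 0))\<^sup>2 = ?g 0" "(sqrt (?g 1))\<^sup>2 = ?g 1" using gram_det_nonneg by simp_all
    ultimately show ?thesis unfolding power2_sum power2_diff by linarith
  qed
  moreover have "(\<Sum>j<n. cmod (det2 (e j)))\<^sup>2 \<le> (cmod k)\<^sup>2"
  proof -
    have "(\<Sum>c<d. z c 0 * cnj t * cnj (z c 3) + z c 1 * t * cnj (z c 2)) = k"
      by (simp add: k_def S_def sum.distrib sum_distrib_left mult_ac)
    then show ?thesis using le by (intro power_mono) (auto intro: sum_nonneg)
  qed
  ultimately have "(\<Sum>j<n. cmod (det2 (e j)))\<^sup>2 + (\<Sum>j<2. sqrt (?g j))\<^sup>2 \<le> ?G"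
    unfolding sum_lessThan_2 using zero_le_power2[of "cmod p"] by linarith
  then show ?thesis unfolding pure_monogamy_def using gram u
    by (intro exI[of _ n] exI[of _ e] exI[of _ u] conjI)
qed

text \<open>First-order optimality: \<open>y\<close> below is the direction in which the determinant would
  grow linearly unless \<open>cnj x\<close> already gives the half traces of the slices.\<close>

lemma extremal_coefficients:
  fixes z :: "nat \<Rightarrow> nat \<Rightarrow> complex" and d :: nat
  defines "comb \<equiv> \<lambda>x r. \<Sum>c<d. x c * z c r"
  assumes x1: "(\<Sum>c<d. (cmod (x c))\<^sup>2) \<le> 1"
    and one: "comb x 0 = 1" "comb x 1 = 0" "comb x 2 = 0" "comb x 3 = 1"
    and max: "\<And>y. (\<Sum>c<d. (cmod (y c))\<^sup>2) \<le> 1 \<Longrightarrow> cmod (det2 (comb y)) \<le> 1"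
    and c: "c < d"
  shows "(\<Sum>c<d. (cmod (x c))\<^sup>2) = 1" and "z c 0 + z c 3 = 2 * cnj (x c)"
proof -
  define n where "n = (\<Sum>c<d. (cmod (x c))\<^sup>2)"
  have n0: "0 \<le> n" by (simp add: n_def sum_nonneg)
  have "n \<noteq> 0"
  proof
    assume "n = 0"
    then have "\<forall>c<d. x c = 0" by (simp add: n_def sum_nonneg_eq_0_iff)
    then show False using one(1) by (simp add: comb_def)
  qed
  then have n: "0 < n" using n0 by simp
  have scale: "comb (\<lambda>c. x c / of_real s) r = comb x r / of_real s" for x s r
    by (simp add: comb_def sum_divide_distrib)
  have nscale: "(\<Sum>c<d. (cmod (x c / of_real s))\<^sup>2) = (\<Sum>c<d. (cmod (x c))\<^sup>2) / s\<^sup>2" for x s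
    by (simp add: norm_divide power_divide sum_divide_distrib)
  \<comment> \<open>Normalising \<open>x\<close> gives a unit superposition of determinant 1 / n, so
    n below 1 would contradict maximality.\<close>
  have "cmod (det2 (comb (\<lambda>c. x c / of_real (sqrt n)))) \<le> 1"
    by (rule max) (use n in \<open>simp add: nscale n_def[symmetric]\<close>)
  moreover have "det2 (comb (\<lambda>c. x c / of_real (sqrt n))) = 1 / of_real n"
    using n one by (simp add: det2_def scale flip: of_real_mult)
  ultimately have "1 \<le> n" using n by (simp add: norm_divide)
  then show n1: "(\<Sum>c<d. (cmod (x c))\<^sup>2) = 1" using x1 n_def by simp
  define q where "q c = (z c 0 + z c 3) / 2" for c
  \<comment> \<open>\<open>y\<close> is orthogonal to \<open>x\<close> (fact \<open>xy\<close>)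
    because the x-weighted half traces sum to 1. Hence x + t y has squared norm 1 + t^2 E, while its
    determinant is 1 + 2 t E up to order t^2. Rescaling to norm 1 and taking t small forces E =
    0.\<close>
  define y where "y c = cnj (q c) - x c" for c
  define E where "E = (\<Sum>c<d. (cmod (y c))\<^sup>2)"
  have E0: "0 \<le> E" by (simp add: E_def sum_nonneg)
  have xq: "(\<Sum>c<d. x c * q c) = 1"
    using one by (simp add: comb_def q_def sum_divide_distrib[symmetric] sum.distrib distrib_left)
  have xx: "(\<Sum>c<d. x c * cnj (x c)) = 1"
    using arg_cong[OF n1, of complex_of_real] by (simp only: of_real_sum of_real_cmod_sq of_real_1)
  have xy: "(\<Sum>c<d. x c * cnj (y c)) = 0"
    using xq xx by (simp add: y_def right_diff_distrib sum_subtractf)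
  have yx: "(\<Sum>c<d. y c * cnj (x c)) = 0"
    using arg_cong[OF xy, of cnj] by (simp add: mult.commute)
  have Ec: "complex_of_real E = (\<Sum>c<d. y c * cnj (y c))"
    by (simp only: E_def of_real_sum of_real_cmod_sq)
  also have "\<dots> = (\<Sum>c<d. y c * q c) - (\<Sum>c<d. y c * cnj (x c))"
    by (simp add: y_def right_diff_distrib sum_subtractf)
  finally have yq: "(\<Sum>c<d. y c * q c) = of_real E" using yx by simp
  have tr: "comb y 0 + comb y 3 = 2 * of_real E"
    using yq by (simp add: comb_def q_def sum_divide_distrib[symmetric] sum.distrib distrib_left)
  have key: "2 * E \<le> t * (E + cmod (det2 (comb y)))" if t: "0 < t" for t :: real
  proof -
    define s where "s = sqrt (1 + t\<^sup>2 * E)"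
    have s2: "s\<^sup>2 = 1 + t\<^sup>2 * E" using E0 by (simp add: s_def)
    have pos: "0 < 1 + t\<^sup>2 * E" using E0 by (simp add: add_pos_nonneg)
    define v where "v c = x c + of_real t * y c" for c
    have "complex_of_real (\<Sum>c<d. (cmod (v c))\<^sup>2) = (\<Sum>c<d. x c * cnj (x c)) + of_real t * (\<Sum>c<d. x c * cnj (y c))
      + of_real t * (\<Sum>c<d. y c * cnj (x c)) + of_real t * of_real t * (\<Sum>c<d. y c * cnj (y c))"
      unfolding of_real_sum of_real_cmod_sq by (simp add: v_def algebra_simps sum.distrib sum_distrib_left)
    also have "\<dots> = complex_of_real (1 + t\<^sup>2 * E)"
      unfolding xx xy yx Ec[symmetric] by (simp add: power2_eq_square)
    finally have vn: "(\<Sum>c<d. (cmod (v c))\<^sup>2) = 1 + t\<^sup>2 * E" by (simp only: of_real_eq_iff)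
    have "cmod (det2 (comb (\<lambda>c. v c / of_real s))) \<le> 1"
      by (rule max) (use pos in \<open>simp add: nscale vn s2\<close>)
    moreover have "det2 (comb (\<lambda>c. v c / of_real s)) = det2 (comb v) / of_real (s\<^sup>2)"
      by (simp add: det2_def scale diff_divide_distrib power2_eq_square)
    ultimately have le: "cmod (det2 (comb v)) \<le> 1 + t\<^sup>2 * E"
      using pos by (simp add: norm_divide s2 flip: of_real_add of_real_mult of_real_power)
    have cv: "comb v r = comb x r + of_real t * comb y r" for r
      by (simp add: comb_def v_def algebra_simps sum.distrib sum_distrib_left)
    have "det2 (comb v) = 1 + of_real t * (comb y 0 + comb y 3) + of_real (t\<^sup>2) * det2 (comb y)"
      by (simp add: det2_def cv one one[simplified] power2_eq_square algebra_simps)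
    also have "\<dots> = of_real (1 + 2 * t * E) - (- of_real (t\<^sup>2) * det2 (comb y))"
      unfolding tr by (simp add: algebra_simps)
    finally have "cmod (of_real (1 + 2 * t * E)) - cmod (- of_real (t\<^sup>2) * det2 (comb y)) \<le> 1 + t\<^sup>2 * E"
      using le norm_triangle_ineq2 by (metis order.trans)
    then have "1 + 2 * t * E - t\<^sup>2 * cmod (det2 (comb y)) \<le> 1 + t\<^sup>2 * E"
      by (simp only: norm_mult norm_minus_cancel norm_of_real) simp
    then have "t * (2 * E) \<le> t * (t * (E + cmod (det2 (comb y))))"
      by (simp add: power2_eq_square algebra_simps)
    then show ?thesis using t by simp
  qed
  have "E = 0"
  proof (rule ccontr)
    assume "E \<noteq> 0"
    then have E: "0 < E" using E0 by simp
    define K where "K = E + cmod (det2 (comb y))"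
    have K: "0 < K" using E by (simp add: K_def add_pos_nonneg)
    \<comment> \<open>The choice t = E / K turns \<open>key\<close> into 2 E at most E.\<close>
    have "2 * E \<le> E / K * K" unfolding K_def by (rule key) (use E K in \<open>simp add: K_def[symmetric]\<close>)
    then show False using E K by simp
  qed
  then have "y c = 0" using c by (simp add: E_def sum_nonneg_eq_0_iff)
  then have "cnj (y c) = 0" by simp
  then show "z c 0 + z c 3 = 2 * cnj (x c)" by (simp add: y_def q_def)
qed

text \<open>By \<open>extremal_coefficients\<close> each slice is cnj (x c) times the identity plus
  a traceless matrix with entries Z, z 1, z 2, -Z, and these three families are orthogonal to the
  identity part. The hypothesis \<open>off\<close> makes the correlations of z 1 and z 2 with Z
  conjugate to each other, so one number \<open>r\<close> describes both. The part along Z is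
  therefore a single traceless matrix c with entries W, W cnj r, W r, -W, where W^2 = h, and the
  residue lives in the two off-diagonal entries. The \<open>AB\<close> ensemble built from these
  parts has determinant sum 1 - \<kappa> + |zz| with \<kappa> = -det c; the measurement of
  \<open>B\<close> is tuned to match it.\<close>

lemma pure_monogamy_normal:
  fixes z :: "nat \<Rightarrow> nat \<Rightarrow> complex" and d :: nat
  defines "comb \<equiv> \<lambda>x r. \<Sum>c<d. x c * z c r"
  assumes x1: "(\<Sum>c<d. (cmod (x c))\<^sup>2) \<le> 1"
    and one: "comb x 0 = 1" "comb x 1 = 0" "comb x 2 = 0" "comb x 3 = 1"
    and max: "\<And>y. (\<Sum>c<d. (cmod (y c))\<^sup>2) \<le> 1 \<Longrightarrow> cmod (det2 (comb y)) \<le> 1"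
    and off: "(\<Sum>c<d. cnj (z c 0) * z c 1 + cnj (z c 2) * z c 3) = 0"
  shows "pure_monogamy d z"
proof -
  define Z where "Z c = (z c 0 - z c 3) / 2" for c
  have "d \<noteq> 0" using one(1) by (intro notI) (simp add: comb_def)
  then have d: "0 < d" by simp
  have xx: "(\<Sum>c<d. x c * cnj (x c)) = 1"
    using arg_cong[OF extremal_coefficients(1)[OF x1 one[unfolded comb_def] max[unfolded comb_def] d], of complex_of_real]
    by (simp only: of_real_sum of_real_cmod_sq of_real_1)
  have q: "z c 0 + z c 3 = 2 * cnj (x c)" if "c < d" for c
    by (rule extremal_coefficients(2)[OF x1 one[unfolded comb_def] max[unfolded comb_def] that])
  have z0: "z c 0 = cnj (x c) + Z c" and z3: "z c 3 = cnj (x c) - Z c" if "c < d" for c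
    using q[OF that] by (simp_all add: Z_def field_simps)
  have xZ: "(\<Sum>c<d. x c * Z c) = 0"
    using one by (simp add: comb_def Z_def sum_divide_distrib[symmetric] right_diff_distrib sum_subtractf)
  have xY: "(\<Sum>c<d. x c * z c 1) = 0" and xX: "(\<Sum>c<d. x c * z c 2) = 0"
    using one by (simp_all add: comb_def)
  have cc: "(\<Sum>c<d. cnj (f c) * cnj (g c)) = cnj (\<Sum>c<d. f c * g c)" for f g :: "nat \<Rightarrow> complex" by simp
  define h where "h = (\<Sum>c<d. (cmod (Z c))\<^sup>2)"
  have h0: "0 \<le> h" by (simp add: h_def sum_nonneg)
  have ZZ: "(\<Sum>c<d. Z c * cnj (Z c)) = of_real h" by (simp only: h_def of_real_sum of_real_cmod_sq)
  define s where "s = (\<Sum>c<d. z c 2 * cnj (Z c))"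
  have cs: "cnj s = (\<Sum>c<d. cnj (z c 2) * Z c)" by (simp add: s_def)
  have YZ: "(\<Sum>c<d. z c 1 * cnj (Z c)) = cnj s"
  proof -
    have "(\<Sum>c<d. cnj (z c 0) * z c 1 + cnj (z c 2) * z c 3) =
      (\<Sum>c<d. x c * z c 1) + (\<Sum>c<d. z c 1 * cnj (Z c)) + (\<Sum>c<d. cnj (x c) * cnj (z c 2)) - (\<Sum>c<d. cnj (z c 2) * Z c)"
      unfolding sum.distrib[symmetric] sum_subtractf[symmetric]
      by (intro sum.cong refl) (simp add: z0 z3 algebra_simps)
    then show ?thesis using off xY xX by (simp only: cc cs[symmetric]) simp
  qed
  \<comment> \<open>If \<open>h = 0\<close> then also \<open>s = 0\<close>, so the junk value \<open>r = 0\<close> still satisfies \<open>s = h r\<close>.\<close>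
  define r where "r = s / of_real h"
  have s: "s = of_real h * r"
  proof (cases "h = 0")
    case True
    then have "\<forall>c<d. Z c = 0" by (simp add: h_def sum_nonneg_eq_0_iff)
    then show ?thesis using True by (simp add: s_def)
  qed (simp add: r_def)
  \<comment> \<open>The conjugate of Z divided by its norm is an admissible coefficient vector. Its
    superposition is c, whose determinant is -h (1 + |r|^2), so maximality applies once
    more.\<close>
  have kappa: "h * (1 + (cmod r)\<^sup>2) \<le> 1"
  proof (cases "h = 0")
    case False
    then have h: "0 < h" using h0 by simp
    define w where "w = sqrt h"
    have w: "w * w = h" "0 < w" using h by (simp_all add: w_def)
    define y where "y c = cnj (Z c) / of_real w" for c
    have "(\<Sum>c<d. (cmod (y c))\<^sup>2) = (\<Sum>c<d. (cmod (Z c))\<^sup>2) / (w * w)"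
      by (simp add: y_def norm_divide power_divide sum_divide_distrib power2_eq_square)
    then have "(\<Sum>c<d. (cmod (y c))\<^sup>2) \<le> 1" using h w by (simp add: h_def[symmetric])
    then have "cmod (det2 (comb y)) \<le> 1" by (rule max)
    moreover have "comb y 0 = of_real w" "comb y 3 = - of_real w" "comb y 1 = of_real w * cnj r" "comb y 2 = of_real w * r"
    proof -
      have "(\<Sum>c<d. cnj (Z c) * cnj (x c)) = 0" using xZ by (simp only: cc mult.commute) simp
      moreover have "(\<Sum>c<d. cnj (Z c) * Z c) = of_real h" using ZZ by (simp only: mult.commute)
      ultimately have "(\<Sum>c<d. cnj (Z c) * z c 0) = of_real h" "(\<Sum>c<d. cnj (Z c) * z c 3) = - of_real h"
        by (simp_all add: z0 z3 distrib_left right_diff_distrib sum.distrib sum_subtractf)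
      moreover have "(\<Sum>c<d. cnj (Z c) * z c 1) = of_real h * cnj r" "(\<Sum>c<d. cnj (Z c) * z c 2) = of_real h * r"
        using YZ s by (simp_all only: s_def mult.commute) simp_all
      moreover have "comb y i = (\<Sum>c<d. cnj (Z c) * z c i) / of_real w" for i
        by (simp add: comb_def y_def sum_divide_distrib)
      ultimately show "comb y 0 = of_real w" "comb y 3 = - of_real w" "comb y 1 = of_real w * cnj r" "comb y 2 = of_real w * r"
        using w unfolding w(1)[symmetric] by simp_all
    qed
    then have "det2 (comb y) = - of_real (h * (1 + (cmod r)\<^sup>2))"
      unfolding of_real_mult of_real_add of_real_cmod_sq w(1)[symmetric]
      by (simp add: det2_def algebra_simps)
    ultimately have "cmod (of_real (h * (1 + (cmod r)\<^sup>2))) \<le> 1" by (simp only: norm_minus_cancel)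
    then show ?thesis unfolding norm_of_real by linarith
  qed simp
  \<comment> \<open>Residuals of z 2 and z 1 after regression on Z. Their orthogonality to Z splits
    the Gram matrix \<open>S\<close> into identity part, Z part and residual part.\<close>
  define X' where "X' c = z c 2 - r * Z c" for c
  define Y' where "Y' c = z c 1 - cnj r * Z c" for c
  define xx' where "xx' = (\<Sum>c<d. (cmod (X' c))\<^sup>2)"
  define yy' where "yy' = (\<Sum>c<d. (cmod (Y' c))\<^sup>2)"
  define zz where "zz = (\<Sum>c<d. X' c * cnj (Y' c))"
  have xx'c: "of_real xx' = (\<Sum>c<d. X' c * cnj (X' c))" by (simp only: xx'_def of_real_sum of_real_cmod_sq)
  have yy'c: "of_real yy' = (\<Sum>c<d. Y' c * cnj (Y' c))" by (simp only: yy'_def of_real_sum of_real_cmod_sq)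
  have X'Z: "(\<Sum>c<d. X' c * cnj (Z c)) = 0"
    using s ZZ by (simp add: X'_def left_diff_distrib sum_subtractf s_def mult.assoc sum_distrib_left[symmetric])
  have Y'Z: "(\<Sum>c<d. Y' c * cnj (Z c)) = 0"
    using s ZZ YZ by (simp add: Y'_def left_diff_distrib sum_subtractf mult.assoc sum_distrib_left[symmetric])
  have ZX': "(\<Sum>c<d. Z c * cnj (X' c)) = 0" using arg_cong[OF X'Z, of cnj] by (simp add: mult.commute)
  have ZY': "(\<Sum>c<d. Z c * cnj (Y' c)) = 0" using arg_cong[OF Y'Z, of cnj] by (simp add: mult.commute)
  define S where "S i j = (\<Sum>c<d. z c i * cnj (z c j))" for i j
  have cS: "cnj (S i j) = S j i" for i j by (simp add: S_def mult.commute)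
  have S22: "S 2 2 = of_real xx' + of_real h * r * cnj r"
  proof -
    have "S 2 2 = (\<Sum>c<d. X' c * cnj (X' c)) + cnj r * (\<Sum>c<d. X' c * cnj (Z c)) + r * (\<Sum>c<d. Z c * cnj (X' c))
        + r * cnj r * (\<Sum>c<d. Z c * cnj (Z c))"
      by (simp add: S_def X'_def sum_distrib_left sum.distrib[symmetric] algebra_simps)
    then show ?thesis unfolding X'Z ZX' ZZ xx'c[symmetric] by simp
  qed
  have S11: "S 1 1 = of_real yy' + of_real h * r * cnj r"
  proof -
    have "S 1 1 = (\<Sum>c<d. Y' c * cnj (Y' c)) + r * (\<Sum>c<d. Y' c * cnj (Z c)) + cnj r * (\<Sum>c<d. Z c * cnj (Y' c))
        + r * cnj r * (\<Sum>c<d. Z c * cnj (Z c))"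
      by (simp add: S_def Y'_def sum_distrib_left sum.distrib[symmetric] algebra_simps)
    then show ?thesis unfolding Y'Z ZY' ZZ yy'c[symmetric] by simp
  qed
  have S21: "S 2 1 = zz + of_real h * r * r"
  proof -
    have "S 2 1 = (\<Sum>c<d. X' c * cnj (Y' c)) + r * (\<Sum>c<d. X' c * cnj (Z c)) + r * (\<Sum>c<d. Z c * cnj (Y' c))
        + r * r * (\<Sum>c<d. Z c * cnj (Z c))"
      by (simp add: S_def X'_def Y'_def sum_distrib_left sum.distrib[symmetric] algebra_simps)
    then show ?thesis unfolding X'Z ZY' ZZ zz_def by simp
  qed
  have Zx: "(\<Sum>c<d. cnj (x c) * cnj (Z c)) = 0" using xZ by (simp only: cc) simp
  have S00: "S 0 0 = 1 + of_real h" and S03: "S 0 3 = 1 - of_real h" and S33: "S 3 3 = 1 + of_real h"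
  proof -
    have *: "(\<Sum>c<d. (cnj (x c) + k * Z c) * cnj (cnj (x c) + l * Z c)) = (\<Sum>c<d. x c * cnj (x c))
        + cnj l * (\<Sum>c<d. cnj (x c) * cnj (Z c)) + k * (\<Sum>c<d. x c * Z c) + k * cnj l * (\<Sum>c<d. Z c * cnj (Z c))" for k l
      unfolding sum_distrib_left sum.distrib[symmetric]
      by (intro sum.cong refl) (simp add: algebra_simps)
    show "S 0 0 = 1 + of_real h" "S 0 3 = 1 - of_real h" "S 3 3 = 1 + of_real h"
      unfolding S_def using *[of 1 1] *[of 1 "- 1"] *[of "- 1" "- 1"]
      by (simp_all only: xx Zx xZ ZZ) (simp_all add: z0 z3 cong: sum.cong_simp)
  qed
  have S10: "S 1 0 = cnj s" "S 1 3 = - cnj s" and S20: "S 2 0 = s" "S 2 3 = - s"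
  proof -
    have *: "(\<Sum>c<d. z c i * cnj (z c 0)) = (\<Sum>c<d. x c * z c i) + (\<Sum>c<d. z c i * cnj (Z c))"
      "(\<Sum>c<d. z c i * cnj (z c 3)) = (\<Sum>c<d. x c * z c i) - (\<Sum>c<d. z c i * cnj (Z c))" for i
      unfolding sum.distrib[symmetric] sum_subtractf[symmetric]
      by (intro sum.cong refl; simp add: z0 z3 algebra_simps)+
    show "S 1 0 = cnj s" "S 1 3 = - cnj s" "S 2 0 = s" "S 2 3 = - s"
      by (simp_all only: S_def * xY xX YZ s_def[symmetric]) simp_all
  qed
  have CS: "(cmod zz)\<^sup>2 \<le> xx' * yy'"
    using gram_det_nonneg[of "{..<d}" X' Y'] by (simp add: gram_det_def xx'_def yy'_def zz_def)
  have xx'0: "0 \<le> xx'" by (simp add: xx'_def sum_nonneg)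
  have yy'0: "0 \<le> yy'" by (simp add: yy'_def sum_nonneg)
  define \<alpha> where "\<alpha> = complex_of_real (sqrt xx')"
  define \<beta> where "\<beta> = cnj zz / \<alpha>"
  define \<gamma> where "\<gamma> = complex_of_real (sqrt (yy' - (cmod zz)\<^sup>2 / xx'))"
  \<comment> \<open>If xx' = 0, then \<open>\<alpha>\<close> is 0 and \<open>\<beta>\<close> is the
    junk quotient 0. By Cauchy-Schwarz zz = 0 too, so the factorisation remains correct.\<close>
  have zz0: "zz = 0" if "xx' = 0" using CS that by simp
  have c\<alpha>: "cnj \<alpha> = \<alpha>" by (simp add: \<alpha>_def)
  have c\<gamma>: "cnj \<gamma> = \<gamma>" by (simp add: \<gamma>_def)
  have \<alpha>\<alpha>: "\<alpha> * \<alpha> = of_real xx'" using xx'0 unfolding \<alpha>_def of_real_mult[symmetric] by simp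
  have \<alpha>\<beta>: "\<alpha> * cnj \<beta> = zz"
    by (cases "xx' = 0") (simp_all add: \<beta>_def c\<alpha> zz0, simp add: \<alpha>_def)
  have \<gamma>\<gamma>: "\<gamma> * \<gamma> = of_real yy' - \<beta> * cnj \<beta>"
  proof -
    have "0 \<le> yy' - (cmod zz)\<^sup>2 / xx'"
      using CS xx'0 yy'0 by (cases "xx' = 0") (simp_all add: divide_le_eq mult.commute)
    then have "\<gamma> * \<gamma> = of_real (yy' - (cmod zz)\<^sup>2 / xx')"
      unfolding \<gamma>_def of_real_mult[symmetric] by simp
    also have "\<dots> = of_real yy' - zz * cnj zz / (\<alpha> * \<alpha>)"
      unfolding of_real_diff of_real_divide of_real_cmod_sq \<alpha>\<alpha> ..
    finally show ?thesis by (simp add: \<beta>_def c\<alpha> mult.commute)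
  qed
  define a where "a = complex_of_real (1 / sqrt 2)"
  have ca: "cnj a = a" by (simp add: a_def)
  have aa: "a * a = 1 / 2" unfolding a_def of_real_mult[symmetric] by simp
  define W where "W = complex_of_real (sqrt h)"
  have cW: "cnj W = W" by (simp add: W_def)
  have WW: "W * W = of_real h" using h0 unfolding W_def of_real_mult[symmetric] by simp
  have sW: "s = W * W * r" by (simp add: WW s)
  \<comment> \<open>The first two vectors are \<open>(1 \<plusminus> c) / sqrt 2\<close>, where the traceless matrix \<open>c\<close> takes up everything
    correlated with \<open>Z\<close>; the last two are a Cholesky factorisation of the rest.\<close>
  define e :: "nat \<Rightarrow> nat \<Rightarrow> complex" where
    "e j = (\<lambda>i. [[a * (1 + W), a * (W * cnj r), a * (W * r), a * (1 - W)],
        [a * (1 - W), - a * (W * cnj r), - a * (W * r), a * (1 + W)],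
        [0, \<beta>, \<alpha>, 0], [0, \<gamma>, 0, 0]] ! j ! i)" for j
  define E where "E i k = (\<Sum>j<4. e j i * cnj (e j k))" for i k
  have cE: "cnj (E i j) = E j i" for i j by (simp add: E_def mult.commute)
  have E: "E i k = (e 0 i * cnj (e 0 k) + e 1 i * cnj (e 1 k)) + (e 2 i * cnj (e 2 k) + e 3 i * cnj (e 3 k))" for i k
    by (simp add: E_def sum_lessThan_4)
  have aax: "a * x * (a * y) = x * y / 2" for x y
  proof -
    have "a * x * (a * y) = (a * a) * (x * y)" by (simp only: mult_ac)
    then show ?thesis by (simp only: aa) simp
  qed
  have "E 0 0 = S 0 0" "E 0 3 = S 0 3" "E 3 3 = S 3 3" "E 1 0 = S 1 0" "E 1 3 = S 1 3" "E 2 0 = S 2 0" "E 2 3 = S 2 3"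
    unfolding E S00 S03 S33 S10 S20 sW WW[symmetric]
    by (simp_all add: e_def ca cW aax) (simp_all add: field_simps)
  moreover have "E 1 1 = S 1 1" "E 2 2 = S 2 2" "E 2 1 = S 2 1"
    unfolding E S11 S22 S21 WW[symmetric] \<alpha>\<alpha>[symmetric] \<alpha>\<beta>[symmetric] using \<gamma>\<gamma>
    by (simp_all add: e_def ca cW c\<alpha> c\<gamma> aax)
  ultimately have ES: "\<forall>i<4. \<forall>k<4. E i k = S i k"
    unfolding all_less_4
    using cE[of 0 3] cE[of 1 0] cE[of 1 3] cE[of 2 0] cE[of 2 3] cE[of 2 1] cS[of 0 3] cS[of 1 0] cS[of 1 3]
      cS[of 2 0] cS[of 2 3] cS[of 2 1] by metis
  define \<kappa> where "\<kappa> = h * (1 + (cmod r)\<^sup>2)"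
  have \<kappa>c: "complex_of_real \<kappa> = W * W + W * r * (W * cnj r)"
    unfolding \<kappa>_def of_real_mult of_real_add of_real_cmod_sq WW[symmetric] by (simp add: algebra_simps)
  have D: "(\<Sum>j<4. cmod (det2 (e j))) = 1 - \<kappa> + cmod zz"
  proof -
    have "det2 (e 0) = of_real ((1 - \<kappa>) / 2)" "det2 (e 1) = of_real ((1 - \<kappa>) / 2)"
      unfolding of_real_divide of_real_diff \<kappa>c
      by (simp_all add: det2_def e_def aax) (simp_all add: field_simps)
    moreover have "cmod (det2 (e 2)) = cmod zz"
      unfolding \<alpha>\<beta>[symmetric] by (simp add: det2_def e_def norm_mult)
    moreover have "det2 (e 3) = 0" by (simp add: det2_def e_def)
    ultimately show ?thesis
      using kappa unfolding sum_lessThan_4 \<kappa>_def[symmetric] by (simp only: norm_of_real) simp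
  qed
  \<comment> \<open>The phase aligning the two terms of \<open>cnj t * S 0 3 + t * S 1 2\<close>.\<close>
  define t where "t = (if zz = 0 then 1 else csqrt (zz / of_real (cmod zz)))"
  have tt: "t * t * cnj zz = of_real (cmod zz)"
  proof (cases "zz = 0")
    case False
    then have "t * t = zz / of_real (cmod zz)" by (simp add: t_def flip: power2_eq_square)
    then have "t * t * cnj zz = (zz * cnj zz) / of_real (cmod zz)" by simp
    then show ?thesis using False unfolding complex_norm_square[symmetric] by (simp add: power2_eq_square)
  qed simp
  have nt: "cmod t = 1"
    by (simp add: t_def norm_csqrt norm_divide)
  then have t1: "t * cnj t = 1" unfolding complex_norm_square[symmetric] by simp
  \<comment> \<open>Up to the phase t, the matrix element equals 1 - h + |zz| + t^2 h (cnj r)^2. The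
    reverse triangle inequality costs at most h |r|^2, and \<kappa> = h + h |r|^2.\<close>
  have "1 - \<kappa> + cmod zz \<le> cmod (of_real (1 - h + cmod zz) - (- (t * t) * (of_real h * cnj r * cnj r)))"
  proof -
    have "cmod (of_real (1 - h + cmod zz)) - cmod (- (t * t) * (of_real h * cnj r * cnj r)) = \<bar>1 - h + cmod zz\<bar> - h * (cmod r)\<^sup>2"
      using nt h0 by (simp only: norm_of_real norm_mult norm_minus_cancel) (simp add: power2_eq_square)
    then show ?thesis
      using norm_triangle_ineq2[of "of_real (1 - h + cmod zz) :: complex" "- (t * t) * (of_real h * cnj r * cnj r)"]
      by (simp add: \<kappa>_def algebra_simps)
  qed
  also have "of_real (1 - h + cmod zz) - (- (t * t) * (of_real h * cnj r * cnj r)) = t * (cnj t * S 0 3 + t * S 1 2)"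
  proof -
    have "S 1 2 = cnj zz + of_real h * cnj r * cnj r" using cS[of 2 1] S21 by simp
    then have "t * (cnj t * S 0 3 + t * S 1 2) = (t * cnj t) * (1 - of_real h) + t * t * cnj zz + t * t * (of_real h * cnj r * cnj r)"
      unfolding S03 by (simp add: algebra_simps)
    then show ?thesis unfolding tt t1 by simp
  qed
  also have "cmod (t * (cnj t * S 0 3 + t * S 1 2)) = cmod (\<Sum>c<d. z c 0 * cnj t * cnj (z c 3) + z c 1 * t * cnj (z c 2))"
    by (simp add: norm_mult nt S_def sum.distrib sum_distrib_left mult_ac)
  finally have "(\<Sum>j<4. cmod (det2 (e j))) \<le> cmod (\<Sum>c<d. z c 0 * cnj t * cnj (z c 3) + z c 1 * t * cnj (z c 2))"
    unfolding D .
  then show ?thesis by (rule pure_monogamyI[OF ES[unfolded E_def S_def] off t1])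
qed

section \<open>Reduction of arbitrary slices to the normal form\<close>

lemma sum_mult2_left: "(\<Sum>c\<in>C. x c * mult2 a (w c) r) = mult2 a (\<lambda>r. \<Sum>c\<in>C. x c * w c r) r"
  unfolding mult2_def sum_distrib_left sum.distrib[symmetric]
  by (intro sum.cong refl) (simp add: algebra_simps)

lemma sum_mult2_right: "(\<Sum>c\<in>C. x c * mult2 (w c) a r) = mult2 (\<lambda>r. \<Sum>c\<in>C. x c * w c r) a r"
  unfolding mult2_def sum_distrib_right sum.distrib[symmetric]
  by (intro sum.cong refl) (simp add: algebra_simps)

lemma pure_monogamy_cong:
  assumes "\<And>c r. r < 4 \<Longrightarrow> w c r = w' c r"
  shows "pure_monogamy d w \<longleftrightarrow> pure_monogamy d w'"
  using assms by (simp add: pure_monogamy_def gram_det_def sum_lessThan_2_times cong: conj_cong)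

text \<open>A maximising superposition exists by compactness. If its determinant is nonzero, local
  operations bring the slices into the form required by \<open>pure_monogamy_normal\<close>, and the
  inverse operations carry the inequality back.\<close>

lemma pure_monogamy_all: "pure_monogamy d w"
proof -
  define comb where "comb x r = (\<Sum>c<d. x c * w c r)" for x :: "nat \<Rightarrow> complex" and r
  \<comment> \<open>Coefficients beyond \<open>d\<close> are confined to the unit disc as well,
    which makes the product of discs compact by Tychonoff. The second fact \<open>max\<close> lifts
    this restriction by setting them to 0.\<close>
  define B where "B = {x :: nat \<Rightarrow> complex. (\<Sum>c<d. (cmod (x c))\<^sup>2) \<le> 1} \<inter> (\<Pi>\<^sub>E c\<in>UNIV. cball 0 1)"
  have cont: "continuous_on A (\<lambda>x :: nat \<Rightarrow> complex. x c)" for A c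
    by (rule continuous_on_subset[OF continuous_on_product_coordinates subset_UNIV])
  have "compactin (product_topology (\<lambda>i. euclidean) UNIV) (\<Pi>\<^sub>E c\<in>(UNIV :: nat set). cball (0 :: complex) 1)"
    by (subst compactin_PiE) simp
  then have "compact (\<Pi>\<^sub>E c\<in>(UNIV :: nat set). cball (0 :: complex) 1)"
    by (simp only: euclidean_product_topology compactin_euclidean_iff)
  moreover have "closed {x :: nat \<Rightarrow> complex. (\<Sum>c<d. (cmod (x c))\<^sup>2) \<le> 1}"
    by (intro closed_Collect_le continuous_on_sum cont continuous_intros)
  ultimately have "compact B" unfolding B_def by (metis compact_Int_closed inf_commute)
  moreover have "(\<lambda>c. 0) \<in> B" by (auto simp: B_def)
  moreover have "continuous_on B (\<lambda>x. cmod (det2 (comb x)))"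
    unfolding det2_def comb_def by (intro continuous_intros cont)
  ultimately obtain x where x: "x \<in> B" and max: "\<And>y. y \<in> B \<Longrightarrow> cmod (det2 (comb y)) \<le> cmod (det2 (comb x))"
    by (metis continuous_attains_sup empty_iff)
  have max: "cmod (det2 (comb y)) \<le> cmod (det2 (comb x))" if "(\<Sum>c<d. (cmod (y c))\<^sup>2) \<le> 1" for y
  proof -
    define y' where "y' c = (if c < d then y c else 0)" for c
    note y1 = that
    have "cmod (y c) \<le> 1" if c: "c < d" for c
    proof -
      have "(cmod (y c))\<^sup>2 \<le> (\<Sum>c<d. (cmod (y c))\<^sup>2)" using c by (intro member_le_sum) auto
      then show ?thesis using y1 by (auto intro: power2_le_imp_le[of _ 1])
    qed
    then have "y' \<in> B" using y1 by (auto simp: B_def y'_def)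
    moreover have "comb y' = comb y" by (simp add: comb_def y'_def fun_eq_iff)
    ultimately show ?thesis using max by metis
  qed
  have x1: "(\<Sum>c<d. (cmod (x c))\<^sup>2) \<le> 1" using x by (simp add: B_def)
  \<comment> \<open>The matrix with rows (k, b) and (cnj b, l) below is the sum of the z_c^dagger
    z_c; the pair p, q gives a unitary on \<open>B\<close> that diagonalises it.\<close>
  have diag: "\<exists>p q. p * cnj p + q * cnj q = 1 \<and>
      (\<Sum>c<d. cnj (z c 0 * p + z c 1 * q) * (z c 1 * cnj p - z c 0 * cnj q)
        + cnj (z c 2 * p + z c 3 * q) * (z c 3 * cnj p - z c 2 * cnj q)) = 0" for z :: "nat \<Rightarrow> nat \<Rightarrow> complex"
  proof -
    define b where "b = (\<Sum>c<d. cnj (z c 0) * z c 1 + cnj (z c 2) * z c 3)"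
    define k where "k = (\<Sum>c<d. (cmod (z c 0))\<^sup>2 + (cmod (z c 2))\<^sup>2)"
    define l where "l = (\<Sum>c<d. (cmod (z c 1))\<^sup>2 + (cmod (z c 3))\<^sup>2)"
    have kc: "of_real k = (\<Sum>c<d. z c 0 * cnj (z c 0) + z c 2 * cnj (z c 2))"
      by (simp only: k_def of_real_sum of_real_add of_real_cmod_sq)
    have lc: "of_real l = (\<Sum>c<d. z c 1 * cnj (z c 1) + z c 3 * cnj (z c 3))"
      by (simp only: l_def of_real_sum of_real_add of_real_cmod_sq)
    obtain p q where pq: "p * cnj p + q * cnj q = 1"
      "b * cnj p * cnj p - cnj b * cnj q * cnj q + of_real (l - k) * cnj p * cnj q = 0"
      using hermitian_2x2_diagonalize[of b l k] by blast
    have "(\<Sum>c<d. cnj (z c 0 * p + z c 1 * q) * (z c 1 * cnj p - z c 0 * cnj q)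
        + cnj (z c 2 * p + z c 3 * q) * (z c 3 * cnj p - z c 2 * cnj q))
      = b * cnj p * cnj p - cnj b * cnj q * cnj q + of_real (l - k) * cnj p * cnj q"
      unfolding of_real_diff kc lc b_def cnj_sum sum_distrib_right sum_subtractf[symmetric] sum.distrib[symmetric]
      by (intro sum.cong refl) (simp add: algebra_simps)
    then show ?thesis using pq by auto
  qed
  show ?thesis
  proof (cases "det2 (comb x) = 0")
    case True
    have det0: "det2 (w c) = 0" if "c < d" for c
    proof -
      define y where "y i = (if i = c then 1 else 0 :: complex)" for i
      have "(\<Sum>i<d. (cmod (y i))\<^sup>2) = (\<Sum>i<d. if i = c then 1 else 0)"
        by (intro sum.cong) (auto simp: y_def)
      then have "(\<Sum>i<d. (cmod (y i))\<^sup>2) \<le> 1" using that by simp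
      then have "det2 (comb y) = 0" using max True by fastforce
      moreover have "comb y = w c"
        using that by (simp add: comb_def y_def fun_eq_iff if_distrib[of "\<lambda>x. x * _"] cong: if_cong)
      ultimately show ?thesis by simp
    qed
    obtain p q where pq: "p * cnj p + q * cnj q = 1"
      "(\<Sum>c<d. cnj (w c 0 * p + w c 1 * q) * (w c 1 * cnj p - w c 0 * cnj q)
        + cnj (w c 2 * p + w c 3 * q) * (w c 3 * cnj p - w c 2 * cnj q)) = 0"
      using diag[of w] by blast
    define v where "v i = [p, - cnj q, q, cnj p] ! i" for i
    define v' where "v' i = [cnj p, cnj q, - q, p] ! i" for i
    define z where "z c = mult2 (w c) v" for c
    have dv: "det2 v = 1" using pq by (simp add: det2_def v_def mult.commute)
    have dv': "det2 v' = 1" using pq by (simp add: det2_def v'_def mult.commute)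
    have "pure_monogamy d z"
    proof (rule pure_monogamyI)
      show "(\<Sum>c<d. cnj (z c 0) * z c 1 + cnj (z c 2) * z c 3) = 0"
        using pq(2) by (simp add: z_def mult2_simps v_def algebra_simps)
      show "(\<Sum>j<d. cmod (det2 (z j))) \<le> cmod (\<Sum>c<d. z c 0 * cnj 1 * cnj (z c 3) + z c 1 * 1 * cnj (z c 2))"
        by (simp add: z_def det2_mult2 det0)
    qed auto
    then have "pure_monogamy d (\<lambda>c. mult2 (z c) v')"
      by (rule pure_monogamy_right) (use pq dv' in \<open>simp_all add: v'_def algebra_simps\<close>)
    moreover have "mult2 (z c) v' r = w c r" for c r
    proof -
      have "\<forall>r<4. mult2 v v' r = one2 r"
        using pq(1) unfolding all_less_4 by (simp add: mult2_simps one2_def v_def v'_def algebra_simps)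
      then have "mult2 (w c) (mult2 v v') r = w c r" by (intro mult2_one_right) simp
      then show ?thesis by (simp only: z_def mult2_assoc)
    qed
    ultimately show ?thesis using pure_monogamy_cong[of "\<lambda>c. mult2 (z c) v'" w d] by simp
  next
    case False
    define g where "g = comb x"
    define \<delta> where "\<delta> = det2 g"
    have \<delta>: "\<delta> \<noteq> 0" "\<delta> = g 0 * g 3 - g 1 * g 2" using False by (simp_all add: \<delta>_def g_def det2_def)
    define g' where "g' i = [g 3, - g 1, - g 2, g 0] ! i / \<delta>" for i
    define y where "y c = mult2 g' (w c)" for c
    obtain p q where pq: "p * cnj p + q * cnj q = 1"
      "(\<Sum>c<d. cnj (y c 0 * p + y c 1 * q) * (y c 1 * cnj p - y c 0 * cnj q)
        + cnj (y c 2 * p + y c 3 * q) * (y c 3 * cnj p - y c 2 * cnj q)) = 0"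
      using diag[of y] by blast
    define v where "v i = [p, - cnj q, q, cnj p] ! i" for i
    define v' where "v' i = [cnj p, cnj q, - q, p] ! i" for i
    \<comment> \<open>The filter sends the maximiser to the identity, and rotating \<open>B\<close>
      by \<open>v\<close> then sends it to \<open>v\<close>. The inverse \<open>v'\<close> on
      \<open>A\<close> restores the identity; as a unitary on the left it does not disturb the
      diagonality obtained for \<open>B\<close>.\<close>
    define z where "z c = mult2 v' (mult2 (y c) v)" for c
    have vv': "mult2 v v' r = one2 r" "mult2 v' v r = one2 r" if "r < 4" for r
    proof -
      have "cnj p * p + cnj q * q = 1" using pq(1) by (simp add: mult.commute)
      then have "\<forall>r<4. mult2 v v' r = one2 r \<and> mult2 v' v r = one2 r"
        using pq(1) unfolding all_less_4 by (simp add: mult2_simps one2_def v_def v'_def algebra_simps)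
      then show "mult2 v v' r = one2 r" "mult2 v' v r = one2 r" using that by auto
    qed
    have gg': "mult2 g g' r = one2 r" "mult2 g' g r = one2 r" if "r < 4" for r
    proof -
      have "\<forall>r<4. mult2 g g' r = one2 r \<and> mult2 g' g r = one2 r"
      proof -
        have "g 0 * g 3 = \<delta> + g 1 * g 2" using \<delta>(2) by simp
        then show ?thesis
          unfolding all_less_4 using \<delta>(1) by (simp add: mult2_simps one2_def g'_def field_simps)
      qed
      then show "mult2 g g' r = one2 r" "mult2 g' g r = one2 r" using that by auto
    qed
    have dv: "det2 v = 1" "det2 v' = 1" using pq by (simp_all add: det2_def v_def v'_def mult.commute)
    have dg': "det2 g' * \<delta> = 1"
    proof -
      have "det2 g' = (g 0 * g 3 - g 1 * g 2) / (\<delta> * \<delta>)"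
        by (simp add: det2_def g'_def diff_divide_distrib mult.commute)
      then show ?thesis using \<delta>(1) unfolding \<delta>(2)[symmetric] by simp
    qed
    have comb_z: "(\<Sum>c<d. k c * z c r) = mult2 v' (mult2 (mult2 g' (comb k)) v) r" for k r
      by (simp add: z_def y_def comb_def[abs_def] sum_mult2_left sum_mult2_right)
    have gx: "mult2 v' (mult2 (mult2 g' (comb x)) v) r = one2 r" if "r < 4" for r
    proof -
      have "mult2 v' (mult2 (mult2 g' (comb x)) v) = mult2 v' v"
        by (rule mult2_cong, rule mult2_one_left) (simp_all add: gg' flip: g_def)
      then show ?thesis using vv' that by simp
    qed
    have "pure_monogamy d z"
    proof (rule pure_monogamy_normal[OF x1])
      show "(\<Sum>c<d. x c * z c 0) = 1" "(\<Sum>c<d. x c * z c 1) = 0" "(\<Sum>c<d. x c * z c 2) = 0" "(\<Sum>c<d. x c * z c 3) = 1"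
        unfolding comb_z by (simp_all add: gx one2_def)
      show "cmod (det2 (\<lambda>r. \<Sum>c<d. k c * z c r)) \<le> 1" if k: "(\<Sum>c<d. (cmod (k c))\<^sup>2) \<le> 1" for k
      proof -
        have "cmod (det2 g') * cmod (det2 (comb k)) \<le> cmod (det2 g') * cmod \<delta>"
          using max[OF k] by (simp add: \<delta>_def g_def mult_left_mono)
        then show ?thesis
          unfolding comb_z by (simp add: det2_mult2 dv norm_mult[symmetric] dg')
      qed
      have "cnj (z c 0) * z c 1 + cnj (z c 2) * z c 3 =
        (p * cnj p + q * cnj q) * (cnj (y c 0 * p + y c 1 * q) * (y c 1 * cnj p - y c 0 * cnj q)
        + cnj (y c 2 * p + y c 3 * q) * (y c 3 * cnj p - y c 2 * cnj q))" for c
      proof -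
        have *: "cnj (cnj p * a + cnj q * b) * (cnj p * a' + cnj q * b') + cnj (- q * a + p * b) * (- q * a' + p * b')
          = (p * cnj p + q * cnj q) * (cnj a * a' + cnj b * b')" for a b a' b'
          by (simp add: algebra_simps)
        show ?thesis
          using *[of "y c 0 * p + y c 1 * q" "y c 2 * p + y c 3 * q" "y c 1 * cnj p - y c 0 * cnj q" "y c 3 * cnj p - y c 2 * cnj q"]
          by (simp add: z_def mult2_simps v_def v'_def add.commute)
      qed
      then show "(\<Sum>c<d. cnj (z c 0) * z c 1 + cnj (z c 2) * z c 3) = 0"
        using pq by simp
    qed
    then have "pure_monogamy d (\<lambda>c. mult2 (mult2 g (mult2 v (z c))) v')"
      by (intro pure_monogamy_right pure_monogamy_left) (use pq dv in \<open>simp_all add: v'_def algebra_simps\<close>)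
    moreover have "mult2 (mult2 g (mult2 v (z c))) v' r = w c r" if "r < 4" for c r
    proof -
      have "mult2 v (z c) r = mult2 (y c) v r" if "r < 4" for r
        unfolding z_def mult2_assoc[symmetric] using that vv' by (simp add: mult2_assoc[of "mult2 v v'"] mult2_one_left)
      then have "mult2 g (mult2 v (z c)) = mult2 (mult2 (mult2 g g') (w c)) v"
        unfolding mult2_assoc y_def by (rule mult2_cong)
      then have "mult2 (mult2 g (mult2 v (z c))) v' r = mult2 (mult2 g g') (w c) r"
        by (simp only: mult2_assoc[of _ v v'] mult2_one_right[OF vv'(1)])
      then show ?thesis using that gg' by (simp add: mult2_one_left)
    qed
    ultimately show ?thesis
      using pure_monogamy_cong[of "\<lambda>c. mult2 (mult2 g (mult2 v (z c))) v'" w d] by simp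
  qed
qed

lemma sum_lessThan_mult:
  fixes f :: "nat \<Rightarrow> 'a :: comm_monoid_add"
  shows "(\<Sum>m<a * b. f m) = (\<Sum>x<a. \<Sum>y<b. f (x * b + y))"
proof -
  have "(\<Sum>y<b. f (x * b + y)) = sum f {x * b..<x * b + b}" for x
    using sum.shift_bounds_nat_ivl[of f 0 "x * b" b] by (simp add: atLeast0LessThan add.commute)
  then show ?thesis using sum.nat_group[of f b a] by simp
qed

subsection \<open>Positive semidefinite forms\<close>

definition sform :: "nat \<Rightarrow> (nat \<Rightarrow> nat \<Rightarrow> complex) \<Rightarrow> (nat \<Rightarrow> complex) \<Rightarrow> (nat \<Rightarrow> complex) \<Rightarrow> complex" where
  "sform n A u v = (\<Sum>r<n. \<Sum>c<n. A r c * v c * cnj (u r))"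

definition nonneg_form :: "nat \<Rightarrow> (nat \<Rightarrow> nat \<Rightarrow> complex) \<Rightarrow> bool" where
  "nonneg_form n A \<longleftrightarrow> (\<forall>v. 0 \<le> sform n A v v)"

lemma psd_iff_nonneg_form:
  "psd n A \<longleftrightarrow> A \<in> carrier_mat n n \<and> nonneg_form n (\<lambda>r c. A $$ (r, c))"
proof -
  have *: "(A *\<^sub>v v) \<bullet>c v = sform n (\<lambda>r c. A $$ (r, c)) (\<lambda>i. v $ i) (\<lambda>i. v $ i)"
    if "A \<in> carrier_mat n n" "v \<in> carrier_vec n" for v
    using that by (auto simp: sform_def scalar_prod_def sum_distrib_right atLeast0LessThan intro!: sum.cong)
  have **: "sform n B v v = sform n B (\<lambda>i. vec n v $ i) (\<lambda>i. vec n v $ i)" for v B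
    by (simp add: sform_def)
  show ?thesis
  proof (intro iffI conjI)
    assume A: "psd n A"
    then show c: "A \<in> carrier_mat n n" by (simp add: psd_def)
    show "nonneg_form n (\<lambda>r c. A $$ (r, c))"
      unfolding nonneg_form_def
    proof
      fix v
      show "0 \<le> sform n (\<lambda>r c. A $$ (r, c)) v v"
        using A *[OF c, of "vec n v"] ** unfolding psd_def by (metis vec_carrier)
    qed
  next
    assume "A \<in> carrier_mat n n \<and> nonneg_form n (\<lambda>r c. A $$ (r, c))"
    then show "psd n A" by (auto simp: psd_def * nonneg_form_def)
  qed
qed

lemma sform_add_scaled:
  "sform n A (\<lambda>i. v i + t * u i) (\<lambda>i. v i + t * u i) =
     sform n A v v + t * sform n A v u + cnj t * sform n A u v + t * cnj t * sform n A u u"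
  unfolding sform_def sum_distrib_left sum.distrib[symmetric]
  by (intro sum.cong refl) (simp add: algebra_simps)

lemma sform_indicator:
  assumes "r < n"
  shows "sform n A (\<lambda>i. if i = r then 1 else 0) v = (\<Sum>c<n. A r c * v c)"
proof -
  have "sform n A (\<lambda>i. if i = r then 1 else 0) v = (\<Sum>i<n. if i = r then \<Sum>c<n. A i c * v c else 0)"
    unfolding sform_def by (intro sum.cong) auto
  then show ?thesis using assms by simp
qed

lemma nonneg_form_Im: "nonneg_form n A \<Longrightarrow> Im (sform n A v v) = 0"
  and nonneg_form_Re: "nonneg_form n A \<Longrightarrow> 0 \<le> Re (sform n A v v)"
  by (auto simp: nonneg_form_def less_eq_complex_def)

text \<open>Polarisation: the form is real at v + u and at v + i u, and these two conditions already
  give Hermitian symmetry.\<close>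

lemma nonneg_form_sform_sym:
  assumes "nonneg_form n A"
  shows "sform n A u v = cnj (sform n A v u)"
proof -
  have "Im (t * sform n A v u + cnj t * sform n A u v) = 0" for t
    using nonneg_form_Im[OF assms, of "\<lambda>i. v i + t * u i"] nonneg_form_Im[OF assms, of u]
      nonneg_form_Im[OF assms, of v] unfolding sform_add_scaled complex_norm_square[symmetric]
    by (simp flip: of_real_power)
  from this[of 1] this[of \<i>] show ?thesis by (simp add: complex_eq_iff)
qed

lemma nonneg_form_hermitian:
  assumes "nonneg_form n A" "r < n" "c < n"
  shows "A r c = cnj (A c r)"
  using nonneg_form_sform_sym[OF assms(1), of "\<lambda>i. if i = r then 1 else 0" "\<lambda>i. if i = c then 1 else 0"] assms(2,3)
  by (simp add: sform_indicator if_distrib[of "\<lambda>x. _ * x"] cong: if_cong)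

text \<open>If entry r of A v were a nonzero number b, a small step from \<open>v\<close> by a
  negative multiple of b along the r-th basis vector would make the form negative to first order.
  The step 1 / (k + 1) is small enough, also when k = 0.\<close>

lemma nonneg_form_kernel:
  assumes A: "nonneg_form n A" and v: "sform n A v v = 0" and r: "r < n"
  shows "(\<Sum>c<n. A r c * v c) = 0"
proof -
  define u where "u i = (if i = r then 1 else 0 :: complex)" for i :: nat
  define b where "b = sform n A u v"
  define k where "k = Re (sform n A u u)"
  have k: "0 \<le> k" "sform n A u u = of_real k"
    using nonneg_form_Re[OF A, of u] nonneg_form_Im[OF A, of u] by (simp_all add: k_def complex_eq_iff)
  have "2 * (cmod b)\<^sup>2 \<le> e * (cmod b)\<^sup>2 * k" if e: "0 < e" for e :: real
  proof -
    define t where "t = - of_real e * b"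
    have "sform n A (\<lambda>i. v i + t * u i) (\<lambda>i. v i + t * u i) = t * cnj b + cnj t * b + t * cnj t * of_real k"
      unfolding sform_add_scaled v nonneg_form_sform_sym[OF A, of v u] b_def[symmetric] k(2) by simp
    also have "\<dots> = of_real (e * (e * (cmod b)\<^sup>2 * k - 2 * (cmod b)\<^sup>2))"
      unfolding of_real_mult of_real_diff of_real_cmod_sq by (simp add: t_def algebra_simps)
    finally have "0 \<le> e * (e * (cmod b)\<^sup>2 * k - 2 * (cmod b)\<^sup>2)"
      using nonneg_form_Re[OF A, of "\<lambda>i. v i + t * u i"] by simp
    then show ?thesis using e by (simp add: zero_le_mult_iff)
  qed
  from this[of "1 / (k + 1)"] k have "2 * (cmod b)\<^sup>2 \<le> (cmod b)\<^sup>2 * (k / (k + 1))" by simp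
  also have "\<dots> \<le> (cmod b)\<^sup>2 * 1" using k by (intro mult_left_mono) auto
  finally have "b = 0" by simp
  then show ?thesis using r unfolding b_def u_def by (simp add: sform_indicator)
qed

lemma nonneg_form_gram: "nonneg_form n (\<lambda>r c. \<Sum>i\<in>I. f i r * cnj (f i c))"
proof -
  have "sform n (\<lambda>r c. \<Sum>i\<in>I. f i r * cnj (f i c)) v v
      = of_real (\<Sum>i\<in>I. (cmod (\<Sum>r<n. f i r * cnj (v r)))\<^sup>2)" for v
  proof -
    have "sform n (\<lambda>r c. \<Sum>i\<in>I. f i r * cnj (f i c)) v v
        = (\<Sum>r<n. \<Sum>c<n. \<Sum>i\<in>I. (f i r * cnj (v r)) * cnj (f i c * cnj (v c)))"
      by (simp add: sform_def sum_distrib_right sum_distrib_left mult_ac)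
    also have "\<dots> = (\<Sum>i\<in>I. \<Sum>r<n. \<Sum>c<n. (f i r * cnj (v r)) * cnj (f i c * cnj (v c)))"
      by (subst sum.swap[of _ _ I], rule sum.cong[OF refl], rule sum.swap)
    finally show ?thesis
      unfolding of_real_sum of_real_cmod_sq cnj_sum sum_product .
  qed
  then show ?thesis by (simp add: nonneg_form_def less_eq_complex_def sum_nonneg)
qed

text \<open>With $X = S - R$, the trace of $X (S + R) X$ is a sum of nonnegative terms and vanishes.\<close>

lemma nonneg_form_sqrt_unique:
  assumes S: "nonneg_form n S" and R: "nonneg_form n R"
    and eq: "\<And>r c. r < n \<Longrightarrow> c < n \<Longrightarrow> (\<Sum>k<n. S r k * S k c) = (\<Sum>k<n. R r k * R k c)"
    and "r < n" "c < n"
  shows "S r c = R r c"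
proof -
  \<comment> \<open>The trace of a product of three matrices. With cyclicity \<open>cyc\<close> and
    the exchange of S S for R R in \<open>sq\<close>, the eight terms of tr X (S + R) X
    cancel.\<close>
  define T where "T A B C = (\<Sum>j<n. \<Sum>r<n. \<Sum>c<n. A j r * B r c * (C c j :: complex))"
    for A B C :: "nat \<Rightarrow> nat \<Rightarrow> complex"
  have cyc: "T A B C = T B C A" for A B C
  proof -
    have "T A B C = (\<Sum>r<n. \<Sum>j<n. \<Sum>c<n. B r c * C c j * A j r)"
      unfolding T_def by (subst sum.swap) (simp add: mult_ac)
    also have "\<dots> = T B C A" unfolding T_def by (rule sum.cong[OF refl], rule sum.swap)
    finally show ?thesis .
  qed
  have sq: "T S S C = T R R C" for C
  proof -
    have *: "T A A C = (\<Sum>j<n. \<Sum>c<n. (\<Sum>r<n. A j r * A r c) * C c j)" for A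
      unfolding T_def sum_distrib_right by (rule sum.cong[OF refl], rule sum.swap)
    show ?thesis unfolding * using eq by (intro sum.cong refl) auto
  qed
  define X where "X r c = S r c - R r c" for r c
  have X: "X c r = cnj (X r c)" if "r < n" "c < n" for r c
    using nonneg_form_hermitian[OF S that(2,1)] nonneg_form_hermitian[OF R that(2,1)] by (simp add: X_def)
  have "(\<Sum>j<n. sform n S (\<lambda>r. X r j) (\<lambda>r. X r j) + sform n R (\<lambda>r. X r j) (\<lambda>r. X r j))
      = T X (\<lambda>r c. S r c + R r c) X"
    unfolding T_def sform_def sum.distrib[symmetric]
    by (intro sum.cong refl) (simp add: X[symmetric] algebra_simps)
  also have "\<dots> = T S S S - T S S R + T S R S - T S R R - T R S S + T R S R - T R R S + T R R R"
    unfolding T_def X_def sum.distrib[symmetric] sum_subtractf[symmetric]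
    by (intro sum.cong refl) (simp add: algebra_simps)
  also have "\<dots> = 0"
    using sq[of S] sq[of R] cyc[of S R S] cyc[of R S S] cyc[of R S R] cyc[of S R R] by simp
  finally have z: "(\<Sum>j<n. sform n S (\<lambda>r. X r j) (\<lambda>r. X r j) + sform n R (\<lambda>r. X r j) (\<lambda>r. X r j)) = 0" .
  have "(\<Sum>j<n. Re (sform n S (\<lambda>r. X r j) (\<lambda>r. X r j)) + Re (sform n R (\<lambda>r. X r j) (\<lambda>r. X r j))) = 0"
    using arg_cong[OF z, of Re] by simp
  then have zz: "Re (sform n S (\<lambda>r. X r j) (\<lambda>r. X r j)) + Re (sform n R (\<lambda>r. X r j) (\<lambda>r. X r j)) = 0" if "j < n" for j
    using that nonneg_form_Re[OF S] nonneg_form_Re[OF R] by (subst (asm) sum_nonneg_eq_0_iff) auto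
  have "sform n S (\<lambda>r. X r j) (\<lambda>r. X r j) = 0" "sform n R (\<lambda>r. X r j) (\<lambda>r. X r j) = 0" if "j < n" for j
    using zz[OF that] nonneg_form_Re[OF S, of "\<lambda>r. X r j"] nonneg_form_Re[OF R, of "\<lambda>r. X r j"]
      nonneg_form_Im[OF S, of "\<lambda>r. X r j"] nonneg_form_Im[OF R, of "\<lambda>r. X r j"]
    by (auto simp: complex_eq_iff)
  then have "(\<Sum>k<n. S r k * X k j) = 0" "(\<Sum>k<n. R r k * X k j) = 0" if "r < n" "j < n" for r j
    using nonneg_form_kernel[OF S] nonneg_form_kernel[OF R] that by blast+
  \<comment> \<open>S X = R X = 0 gives X X = 0, and the diagonal entries of X X are the squared
    column norms of the Hermitian X.\<close>
  then have "(\<Sum>k<n. X c k * X k c) = 0"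
    using \<open>c < n\<close> unfolding X_def[of c] left_diff_distrib sum_subtractf by simp
  moreover have "(\<Sum>k<n. X c k * X k c) = (\<Sum>k<n. X k c * cnj (X k c))"
    by (rule sum.cong[OF refl]) (metis X \<open>c < n\<close> lessThan_iff mult.commute)
  ultimately have "complex_of_real (\<Sum>k<n. (cmod (X k c))\<^sup>2) = 0"
    unfolding of_real_sum of_real_cmod_sq by simp
  then have "(\<Sum>k<n. (cmod (X k c))\<^sup>2) = 0" by (simp only: of_real_eq_0_iff)
  then have "X r c = 0" using \<open>r < n\<close> by (simp add: sum_nonneg_eq_0_iff)
  then show ?thesis by (simp add: X_def)
qed

lemma psd_sqrt_eqI:
  assumes A: "A \<in> carrier_mat n n" and S: "psd n S" and eq: "S * S = A"
  shows "psd_sqrt A = S"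
  unfolding psd_sqrt_def
proof (rule the_equality)
  show "psd (dim_row A) S \<and> S * S = A" using assms by simp
next
  fix R
  assume "psd (dim_row A) R \<and> R * R = A"
  then have R: "psd n R" "R * R = S * S" using A eq by auto
  have cS: "S \<in> carrier_mat n n" "R \<in> carrier_mat n n" using S R by (auto simp: psd_def)
  have e: "(B * B) $$ (r, c) = (\<Sum>k<n. B $$ (r, k) * B $$ (k, c))" if "B \<in> carrier_mat n n" "r < n" "c < n"
    for B :: "complex mat" and r c
    using that by (simp add: scalar_prod_def atLeast0LessThan)
  have "R $$ (r, c) = S $$ (r, c)" if "r < n" "c < n" for r c
    by (rule nonneg_form_sqrt_unique[where n = n and S = "\<lambda>r c. R $$ (r, c)" and R = "\<lambda>r c. S $$ (r, c)"])
      (use S R that cS in \<open>auto simp: psd_iff_nonneg_form e[symmetric]\<close>)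
  then show "R = S" using cS by (intro eq_matI) auto
qed

text \<open>Cholesky elimination: after \<open>k\<close> steps the first \<open>k\<close> rows and columns vanish.\<close>

lemma nonneg_form_gram_decomposition:
  assumes "nonneg_form n A"
  shows "\<exists>v. \<forall>r<n. \<forall>c<n. A r c = (\<Sum>i<n. v i r * cnj (v i c))"
proof -
  have "\<exists>v. \<forall>r<n. \<forall>c<n. A r c = (\<Sum>i\<in>{k..<n}. v i r * cnj (v i c))"
    if "k \<le> n" "nonneg_form n A" "\<forall>r<n. \<forall>c<n. r < k \<or> c < k \<longrightarrow> A r c = 0" for k A
    using that
  proof (induction k arbitrary: A rule: inc_induct)
    case base
    then show ?case by auto
  next
    case (step k)
    note A = step.prems(1)
    define a where "a = Re (A k k)"
    have kk: "sform n A (\<lambda>i. if i = k then 1 else 0) (\<lambda>i. if i = k then 1 else 0) = A k k"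
      using step.hyps by (simp add: sform_indicator if_distrib[of "\<lambda>x. _ * x"] cong: if_cong)
    have a: "0 \<le> a" "A k k = of_real a"
      using nonneg_form_Re[OF A, of "\<lambda>i. if i = k then 1 else 0"] nonneg_form_Im[OF A, of "\<lambda>i. if i = k then 1 else 0"]
      unfolding kk by (simp_all add: a_def complex_eq_iff)
    \<comment> \<open>A zero pivot forces a zero column (fact \<open>row\<close>), so the junk
      quotient \<open>w\<close> = 0 is the right value.\<close>
    define w where "w r = A r k / of_real (sqrt a)" for r
    have row: "A r k = 0" if "a = 0" "r < n" for r
    proof -
      have "(\<Sum>c<n. A r c * (if c = k then 1 else 0)) = 0"
        by (rule nonneg_form_kernel[OF A _ that(2)]) (simp add: kk a that)
      then show ?thesis using step.hyps by (simp add: if_distrib[of "\<lambda>x. _ * x"] cong: if_cong)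
    qed
    have ww: "w r * cnj (w c) = A r k * A k c / of_real a" if "r < n" "c < n" for r c
    proof -
      have "complex_of_real (sqrt a) * complex_of_real (sqrt a) = of_real a"
        using a(1) unfolding of_real_mult[symmetric] by simp
      moreover have "cnj (A c k) = A k c" using nonneg_form_hermitian[OF A, of k c] step.hyps that by simp
      ultimately show ?thesis by (simp add: w_def)
    qed
    define B where "B r c = A r c - w r * cnj (w c)" for r c
    have "nonneg_form n B"
      unfolding nonneg_form_def
    proof
      fix v
      define b where "b = (\<Sum>c<n. A k c * v c)"
      define u where "u i = (if i = k then 1 else 0 :: complex)" for i :: nat
      have u: "sform n A u v = b" "sform n A u u = of_real a"
        using step.hyps kk a by (simp_all add: u_def[abs_def] b_def sform_indicator)
      have vu: "sform n A v u = cnj b" using nonneg_form_sform_sym[OF A, of v u] u by simp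
      have b0: "b = 0" if "a = 0"
        using that row nonneg_form_hermitian[OF A, of k] step.hyps by (auto simp: b_def intro!: sum.neutral)
      have 1: "sform n B v v = sform n A v v - b * cnj b / of_real a"
      proof -
        have cb: "cnj b = (\<Sum>r<n. A r k * cnj (v r))"
          unfolding b_def cnj_sum using nonneg_form_hermitian[OF A, of _ k] step.hyps by (intro sum.cong refl) simp
        have "cnj b * b = (\<Sum>r<n. \<Sum>c<n. A r k * cnj (v r) * (A k c * v c))"
          by (simp only: cb) (simp only: b_def sum_product)
        then have "cnj b * b / of_real a = (\<Sum>r<n. \<Sum>c<n. A r k * A k c / of_real a * v c * cnj (v r))"
          by (simp add: sum_divide_distrib mult_ac)
        then have "b * cnj b / of_real a = (\<Sum>r<n. \<Sum>c<n. A r k * A k c / of_real a * v c * cnj (v r))"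
          by (simp only: mult.commute)
        then show ?thesis
          unfolding sform_def by (simp add: B_def ww left_diff_distrib sum_subtractf)
      qed
      \<comment> \<open>Completing the square: the form of the Schur complement at \<open>v\<close>
        is the form of \<open>A\<close> at \<open>v\<close> shifted along the k-th basis
        vector.\<close>
      have 2: "sform n A v v - b * cnj b / of_real a = sform n A (\<lambda>i. v i + (- b / of_real a) * u i) (\<lambda>i. v i + (- b / of_real a) * u i)"
        unfolding sform_add_scaled u vu by (cases "a = 0") (simp_all add: b0 field_simps)
      show "0 \<le> sform n B v v" unfolding 1 2 using A by (simp only: nonneg_form_def)
    qed
    moreover have "\<forall>r<n. \<forall>c<n. r < Suc k \<or> c < Suc k \<longrightarrow> B r c = 0"
    proof (intro allI impI)
      fix r c assume rc: "r < n" "c < n" "r < Suc k \<or> c < Suc k"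
      have k: "k < n" using step.hyps by simp
      show "B r c = 0"
      proof (cases "a = 0")
        case True
        have "A k c = 0" using row[OF True, of c] nonneg_form_hermitian[OF A k rc(2)] rc by simp
        then show ?thesis
          using row[OF True] rc step.prems(2) k by (auto simp: B_def ww less_Suc_eq)
      next
        case False
        then show ?thesis
          using rc step.prems(2) k by (auto simp: B_def ww a less_Suc_eq)
      qed
    qed
    ultimately obtain v where v: "\<forall>r<n. \<forall>c<n. B r c = (\<Sum>i\<in>{Suc k..<n}. v i r * cnj (v i c))"
      using step.IH by blast
    have "A r c = (\<Sum>i\<in>{k..<n}. (v(k := w)) i r * cnj ((v(k := w)) i c))" if "r < n" "c < n" for r c
    proof -
      have "(\<Sum>i\<in>{k..<n}. (v(k := w)) i r * cnj ((v(k := w)) i c)) =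
        w r * cnj (w c) + (\<Sum>i\<in>{Suc k..<n}. (v(k := w)) i r * cnj ((v(k := w)) i c))"
        using step.hyps by (simp add: sum.atLeast_Suc_lessThan)
      also have "(\<Sum>i\<in>{Suc k..<n}. (v(k := w)) i r * cnj ((v(k := w)) i c)) = B r c"
        using v that by simp
      finally show ?thesis by (simp add: B_def)
    qed
    then show ?case by blast
  qed
  from this[of 0 A] assms show ?thesis by (simp add: atLeast0LessThan)
qed

subsection \<open>Negativity of pure states\<close>

lemma nonneg_form_cong:
  "(\<And>r c. r < n \<Longrightarrow> c < n \<Longrightarrow> A r c = B r c) \<Longrightarrow> nonneg_form n A \<longleftrightarrow> nonneg_form n B"
  by (simp add: nonneg_form_def sform_def)

text \<open>Orthogonality of the middle family leaves only the diagonal terms, weighted by squared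
  norms. In \<open>negativity_pure\<close> it evaluates both S S and Z Z^dagger.\<close>

lemma orthogonal_dyads_mult:
  assumes "finite I"
    and "\<And>i j. i \<in> I \<Longrightarrow> j \<in> I \<Longrightarrow> (\<Sum>m<n. cnj (e i m) * e j m) = (if i = j then w i else 0 :: complex)"
  shows "(\<Sum>m<n. (\<Sum>i\<in>I. f i r * cnj (e i m)) * (\<Sum>j\<in>I. e j m * h j c)) = (\<Sum>i\<in>I. w i * f i r * h i c)"
proof -
  have "(\<Sum>m<n. (\<Sum>i\<in>I. f i r * cnj (e i m)) * (\<Sum>j\<in>I. e j m * h j c))
      = (\<Sum>m<n. \<Sum>i\<in>I. \<Sum>j\<in>I. f i r * h j c * (cnj (e i m) * e j m))"
    unfolding sum_product by (simp add: mult_ac)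
  also have "\<dots> = (\<Sum>i\<in>I. \<Sum>j\<in>I. \<Sum>m<n. f i r * h j c * (cnj (e i m) * e j m))"
    by (subst sum.swap, rule sum.cong[OF refl], rule sum.swap)
  also have "\<dots> = (\<Sum>i\<in>I. \<Sum>j\<in>I. if i = j then w i * f i r * h i c else 0)"
    unfolding sum_distrib_left[symmetric] by (intro sum.cong refl) (simp add: assms(2))
  finally show ?thesis using assms(1) by simp
qed

text \<open>Vectors need not be normalised: the quantity is quadratic in \<open>v\<close>, so it
  absorbs probabilities (\<open>concurrence_scale\<close>).\<close>

definition concurrence :: "nat \<Rightarrow> (nat \<Rightarrow> complex) \<Rightarrow> real" where
  "concurrence d v = 2 * sqrt (gram_det {..<d} v (\<lambda>y. v (d + y)))"

lemma concurrence_nonneg: "0 \<le> concurrence d v"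
  by (simp add: concurrence_def gram_det_nonneg)

lemma concurrence_scale: "concurrence d (\<lambda>i. a * v i) = (cmod a)\<^sup>2 * concurrence d v"
proof -
  have "gram_det {..<d} (\<lambda>y. a * v y) (\<lambda>y. a * v (d + y)) = ((cmod a)\<^sup>2)\<^sup>2 * gram_det {..<d} v (\<lambda>y. v (d + y))"
    using gram_det_linear[of "{..<d}" a v 0 "\<lambda>y. v (d + y)" 0 a] by (simp add: norm_mult power_mult_distrib power2_eq_square)
  then show ?thesis by (simp only: concurrence_def real_sqrt_mult real_sqrt_abs) simp
qed

lemma concurrence_cong: "(\<And>i. i < 2 * d \<Longrightarrow> v i = w i) \<Longrightarrow> concurrence d v = concurrence d w"
  by (simp add: concurrence_def gram_det_def)

text \<open>Diagonalising the Gram matrix of the two halves of the state yields a Schmidt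
  decomposition $\sum_k u_k \otimes \varphi_k$ with orthogonal, unnormalised $\varphi_k$. The vectors
  $\overline{u_k} \otimes \varphi_l$ diagonalise the absolute value \<open>S\<close> of the partial transpose \<open>Z\<close>.
  If $\varphi_l = 0$, the junk value $x / 0 = 0$ is the right coefficient.\<close>

lemma negativity_pure:
  assumes \<psi>: "pure_state (2 * d) \<psi>"
  shows "negativity 2 d (projector \<psi>) = concurrence d (\<lambda>i. \<psi> $ i)"
proof -
  define f where "f x y = \<psi> $ (x * d + y)" for x y
  have dim: "dim_vec \<psi> = 2 * d" using \<psi> by (simp add: pure_state_def)
  define b where "b = (\<Sum>y<d. f 0 y * cnj (f 1 y))"
  define g0 where "g0 = (\<Sum>y<d. (cmod (f 0 y))\<^sup>2)"
  define g1 where "g1 = (\<Sum>y<d. (cmod (f 1 y))\<^sup>2)"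
  have g0c: "of_real g0 = (\<Sum>y<d. f 0 y * cnj (f 0 y))" by (simp only: g0_def of_real_sum of_real_cmod_sq)
  have g1c: "of_real g1 = (\<Sum>y<d. f 1 y * cnj (f 1 y))" by (simp only: g1_def of_real_sum of_real_cmod_sq)
  obtain p q where pq: "p * cnj p + q * cnj q = 1"
    "b * cnj p * cnj p - cnj b * cnj q * cnj q + of_real (g1 - g0) * cnj p * cnj q = 0"
    using hermitian_2x2_diagonalize[of b g1 g0] by blast
  have pq': "cnj p * p + cnj q * q = 1" using pq(1) by (simp add: mult.commute)
  define \<phi> where "\<phi> k y = (if k = 0 then cnj p * f 0 y + cnj q * f 1 y else p * f 1 y - q * f 0 y)" for k :: nat and y
  define u where "u k x = (if k = 0 then if x = 0 then p else q else if x = 0 then - cnj q else cnj p)" for k x :: nat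
  have f\<phi>: "f x y = (\<Sum>k<2. u k x * \<phi> k y)" if "x < 2" for x y
  proof -
    have "f x y = (p * cnj p + q * cnj q) * f x y" using pq(1) by simp
    then show ?thesis using that by (auto simp: less_2_cases_iff sum_lessThan_2 u_def \<phi>_def algebra_simps)
  qed
  have u: "(\<Sum>x<2. u k x * cnj (u l x)) = (if k = l then 1 else 0)" if "k < 2" "l < 2" for k l
    using that pq(1) pq' by (auto simp: less_2_cases_iff sum_lessThan_2 u_def add.commute)
  define \<mu> where "\<mu> k = (\<Sum>y<d. (cmod (\<phi> k y))\<^sup>2)" for k
  have \<mu>0: "0 \<le> \<mu> k" for k by (simp add: \<mu>_def sum_nonneg)
  have \<mu>c: "of_real (\<mu> k) = (\<Sum>y<d. \<phi> k y * cnj (\<phi> k y))" for k by (simp only: \<mu>_def of_real_sum of_real_cmod_sq)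
  have orth: "(\<Sum>y<d. \<phi> 0 y * cnj (\<phi> 1 y)) = 0"
  proof -
    have "(\<Sum>y<d. \<phi> 0 y * cnj (\<phi> 1 y)) = b * cnj p * cnj p - cnj b * cnj q * cnj q + of_real (g1 - g0) * cnj p * cnj q"
      unfolding of_real_diff g0c g1c b_def cnj_sum sum_distrib_right sum_subtractf[symmetric] sum.distrib[symmetric]
      by (intro sum.cong refl) (simp add: \<phi>_def algebra_simps)
    then show ?thesis using pq(2) by simp
  qed
  have orth': "(\<Sum>y<d. \<phi> 1 y * cnj (\<phi> 0 y)) = 0" using arg_cong[OF orth, of cnj] by (simp add: mult.commute)
  have \<phi>\<phi>: "(\<Sum>y<d. \<phi> l y * cnj (\<phi> k y)) = (if k = l then of_real (\<mu> k) else 0)" if "k < 2" "l < 2" for k l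
    using that orth orth' by (auto simp: less_2_cases_iff \<mu>c)
  have det: "\<mu> 0 * \<mu> 1 = gram_det {..<d} (f 0) (f 1)"
  proof -
    have "gram_det {..<d} (\<phi> 0) (\<phi> 1) = gram_det {..<d} (\<lambda>y. cnj p * f 0 y + cnj q * f 1 y) (\<lambda>y. (- q) * f 0 y + p * f 1 y)"
      by (simp add: \<phi>_def[abs_def] gram_det_def)
    also have "\<dots> = gram_det {..<d} (f 0) (f 1)" unfolding gram_det_linear using pq' by (simp add: mult.commute)
    finally show ?thesis using orth by (simp add: gram_det_def \<mu>_def)
  qed
  have tr: "\<mu> 0 + \<mu> 1 = 1"
  proof -
    have "\<psi> \<bullet>c \<psi> = (\<Sum>m<2 * d. \<psi> $ m * cnj (\<psi> $ m))"
      using dim by (simp add: scalar_prod_def atLeast0LessThan)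
    also have "\<dots> = (\<Sum>y<d. f 0 y * cnj (f 0 y)) + (\<Sum>y<d. f 1 y * cnj (f 1 y))"
      by (simp add: sum_lessThan_mult sum_lessThan_2 f_def)
    also have "\<dots> = (p * cnj p + q * cnj q) * (\<Sum>y<d. f 0 y * cnj (f 0 y) + f 1 y * cnj (f 1 y))"
      using pq(1) by (simp add: sum.distrib)
    also have "\<dots> = (\<Sum>y<d. \<phi> 0 y * cnj (\<phi> 0 y)) + (\<Sum>y<d. \<phi> 1 y * cnj (\<phi> 1 y))"
      unfolding sum_distrib_left sum.distrib[symmetric]
      by (intro sum.cong refl) (simp add: \<phi>_def algebra_simps)
    also have "\<dots> = of_real (\<mu> 0 + \<mu> 1)" by (simp add: \<mu>c)
    finally show ?thesis using \<psi> by (simp add: pure_state_def flip: of_real_add)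
  qed
  define I where "I = {..<2::nat} \<times> {..<2::nat}"
  have I: "finite I" by (simp add: I_def)
  define e where "e i m = cnj (u (fst i) (m div d)) * \<phi> (snd i) (m mod d)" for i m
  have ee: "(\<Sum>m<2 * d. cnj (e i m) * e j m) = (if i = j then of_real (\<mu> (snd i)) else 0)" if "i \<in> I" "j \<in> I" for i j
  proof -
    have "(\<Sum>m<2 * d. cnj (e i m) * e j m) = (\<Sum>x<2. \<Sum>y<d. (u (fst i) x * cnj (u (fst j) x)) * (\<phi> (snd j) y * cnj (\<phi> (snd i) y)))"
      unfolding sum_lessThan_mult by (intro sum.cong refl) (simp add: e_def mult_ac)
    also have "\<dots> = (\<Sum>x<2. u (fst i) x * cnj (u (fst j) x)) * (\<Sum>y<d. \<phi> (snd j) y * cnj (\<phi> (snd i) y))"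
      by (simp only: sum_product)
    also have "\<dots> = (if i = j then of_real (\<mu> (snd i)) else 0)"
      using that by (auto simp: I_def u \<phi>\<phi> split: if_splits)
    finally show ?thesis .
  qed
  define Z where "Z = partial_transpose 2 d (projector \<psi>)"
  have Zc: "Z \<in> carrier_mat (2 * d) (2 * d)" by (simp add: Z_def partial_transpose_def)
  \<comment> \<open>Exchanging the indices describes the action of \<open>Z\<close>: it maps e_i to
    \<open>\<mu> (snd i)\<close> times e_(s i). So Z Z^dagger is diagonal in the e_i.\<close>
  define s where "s i = (snd i, fst i)" for i :: "nat \<times> nat"
  have Z: "Z $$ (r, c) = (\<Sum>i\<in>I. e (s i) r * cnj (e i c))" if rc: "r < 2 * d" "c < 2 * d" for r c
  proof -
    have d: "0 < d" using rc by (cases d) auto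
    have lt: "r div d < 2" "c div d < 2" using rc by (simp_all add: less_mult_imp_div_less)
    have md: "r mod d < d" "c mod d < d" using d by simp_all
    have ix: "x * d + y < 2 * d" if "x < 2" "y < d" for x y
    proof -
      have "x * d + y < x * d + d" using that by simp
      also have "\<dots> = (x + 1) * d" by simp
      also have "\<dots> \<le> 2 * d" using that by (intro mult_right_mono) auto
      finally show ?thesis .
    qed
    have "Z $$ (r, c) = f (c div d) (r mod d) * cnj (f (r div d) (c mod d))"
      using rc lt md dim ix by (simp add: Z_def partial_transpose_def projector_def f_def)
    also have "\<dots> = (\<Sum>k<2. u k (c div d) * \<phi> k (r mod d)) * (\<Sum>l<2. cnj (u l (r div d)) * cnj (\<phi> l (c mod d)))"
      using lt by (simp add: f\<phi>)
    also have "\<dots> = (\<Sum>k<2. \<Sum>l<2. (u k (c div d) * \<phi> k (r mod d)) * (cnj (u l (r div d)) * cnj (\<phi> l (c mod d))))"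
      by (simp only: sum_product)
    also have "\<dots> = (\<Sum>i\<in>I. e (s i) r * cnj (e i c))"
      by (simp add: I_def sum.cartesian_product[symmetric] split_def s_def e_def mult_ac)
        (simp add: sum.cartesian_product split_def mult_ac)
    finally show ?thesis .
  qed
  \<comment> \<open>Z Z^dagger is the sum of \<open>\<mu> (fst i)\<close> e_i e_i^dagger, while
    squaring \<open>S\<close> gives the coefficients a_i^2 \<open>\<mu> (snd i)\<close>; equating
    them determines a_i.\<close>
  define a where "a i = sqrt (\<mu> (fst i) / \<mu> (snd i))" for i :: "nat \<times> nat"
  define S where "S = mat (2 * d) (2 * d) (\<lambda>(r, c). \<Sum>i\<in>I. of_real (a i) * e i r * cnj (e i c))"
  have Sc: "S \<in> carrier_mat (2 * d) (2 * d)" by (simp add: S_def)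
  have a0: "0 \<le> a i" for i using \<mu>0 by (simp add: a_def)
  have "psd (2 * d) S"
  proof -
    have sq: "complex_of_real (sqrt (a i)) * complex_of_real (sqrt (a i)) = of_real (a i)" for i
      using a0[of i] unfolding of_real_mult[symmetric] by simp
    have "nonneg_form (2 * d) (\<lambda>r c. \<Sum>i\<in>I. (of_real (sqrt (a i)) * e i r) * cnj (of_real (sqrt (a i)) * e i c))"
      by (rule nonneg_form_gram)
    moreover have "(\<Sum>i\<in>I. (of_real (sqrt (a i)) * e i r) * cnj (of_real (sqrt (a i)) * e i c)) = S $$ (r, c)"
      if "r < 2 * d" "c < 2 * d" for r c
    proof -
      have "(\<Sum>i\<in>I. (of_real (sqrt (a i)) * e i r) * cnj (of_real (sqrt (a i)) * e i c)) =
        (\<Sum>i\<in>I. (complex_of_real (sqrt (a i)) * complex_of_real (sqrt (a i))) * e i r * cnj (e i c))"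
        by (simp add: mult_ac)
      then show ?thesis unfolding sq using that by (simp add: S_def)
    qed
    ultimately show ?thesis
      unfolding psd_iff_nonneg_form using Sc nonneg_form_cong by (metis (no_types, lifting))
  qed
  moreover have "S * S = Z * mat_adjoint Z"
  proof (rule eq_matI)
    fix r c assume "r < dim_row (Z * mat_adjoint Z)" "c < dim_col (Z * mat_adjoint Z)"
    then have rc: "r < 2 * d" "c < 2 * d" using Zc by (auto simp: mat_adjoint_def)
    have "(S * S) $$ (r, c) = (\<Sum>m<2 * d. (\<Sum>i\<in>I. (of_real (a i) * e i r) * cnj (e i m)) * (\<Sum>j\<in>I. e j m * (of_real (a j) * cnj (e j c))))"
      using rc by (simp add: S_def scalar_prod_def atLeast0LessThan mult_ac)
    also have "\<dots> = (\<Sum>i\<in>I. of_real (\<mu> (snd i)) * (of_real (a i) * e i r) * (of_real (a i) * cnj (e i c)))"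
      by (rule orthogonal_dyads_mult[OF I ee])
    also have "\<dots> = (\<Sum>i\<in>I. of_real (\<mu> (fst i)) * e i r * cnj (e i c))"
    proof (rule sum.cong[OF refl])
      fix i
      show "of_real (\<mu> (snd i)) * (of_real (a i) * e i r) * (of_real (a i) * cnj (e i c)) = of_real (\<mu> (fst i)) * e i r * cnj (e i c)"
      proof (cases "\<mu> (snd i) = 0")
        case True
        then have "\<phi> (snd i) y = 0" if "y < d" for y using that by (simp add: \<mu>_def sum_nonneg_eq_0_iff)
        moreover have "r mod d < d" using rc by (cases d) auto
        ultimately have "e i r = 0" by (simp add: e_def)
        then show ?thesis by simp
      next
        case False
        have "\<mu> (snd i) * (a i * a i) = \<mu> (fst i)"
          using False \<mu>0 by (simp add: a_def)
        then have "complex_of_real (\<mu> (snd i)) * (of_real (a i) * of_real (a i)) = of_real (\<mu> (fst i))"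
          by (simp flip: of_real_mult)
        then show ?thesis by (metis mult.assoc mult.left_commute)
      qed
    qed
    also have "\<dots> = (\<Sum>i\<in>I. of_real (\<mu> (snd i)) * e (s i) r * cnj (e (s i) c))"
      by (rule sum.reindex_bij_witness[of _ s s]) (auto simp: s_def I_def)
    also have "\<dots> = (\<Sum>m<2 * d. (\<Sum>i\<in>I. e (s i) r * cnj (e i m)) * (\<Sum>j\<in>I. e j m * cnj (e (s j) c)))"
      by (rule orthogonal_dyads_mult[OF I ee, symmetric])
    also have "\<dots> = (\<Sum>m<2 * d. Z $$ (r, m) * cnj (Z $$ (c, m)))"
      using rc by (simp add: Z mult.commute)
    also have "\<dots> = (Z * mat_adjoint Z) $$ (r, c)"
      using rc Zc by (simp add: mat_adjoint_def scalar_prod_def atLeast0LessThan mat_of_rows_def)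
    finally show "(S * S) $$ (r, c) = (Z * mat_adjoint Z) $$ (r, c)" .
  qed (use Sc Zc in \<open>auto simp: mat_adjoint_def\<close>)
  moreover have "Z * mat_adjoint Z \<in> carrier_mat (2 * d) (2 * d)" using Zc by (auto simp: mat_adjoint_def)
  ultimately have "psd_sqrt (Z * mat_adjoint Z) = S" by (intro psd_sqrt_eqI)
  then have "trace_norm Z = Re (\<Sum>m<2 * d. \<Sum>i\<in>I. of_real (a i) * (cnj (e i m) * e i m))"
    by (simp add: trace_norm_def mat_trace_def S_def mult_ac)
  also have "(\<Sum>m<2 * d. \<Sum>i\<in>I. of_real (a i) * (cnj (e i m) * e i m)) = (\<Sum>i\<in>I. of_real (a i) * (\<Sum>m<2 * d. cnj (e i m) * e i m))"
    by (subst sum.swap) (simp add: sum_distrib_left)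
  also have "\<dots> = (\<Sum>i\<in>I. of_real (sqrt (\<mu> (fst i)) * sqrt (\<mu> (snd i))))"
  proof (rule sum.cong[OF refl])
    fix i assume i: "i \<in> I"
    have "a i * \<mu> (snd i) = sqrt (\<mu> (fst i)) * sqrt (\<mu> (snd i))"
      using \<mu>0[of "snd i"] by (cases "\<mu> (snd i) = 0") (simp_all add: a_def real_sqrt_divide field_simps)
    then show "of_real (a i) * (\<Sum>m<2 * d. cnj (e i m) * e i m) = of_real (sqrt (\<mu> (fst i)) * sqrt (\<mu> (snd i)))"
      using i by (simp add: ee flip: of_real_mult)
  qed
  also have "Re \<dots> = (sqrt (\<mu> 0) + sqrt (\<mu> 1))\<^sup>2"
    by (simp add: I_def sum_lessThan_2_times sum_lessThan_2 power2_eq_square algebra_simps)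
  also have "\<dots> = 1 + 2 * sqrt (\<mu> 0 * \<mu> 1)"
    using \<mu>0 tr by (simp add: power2_sum real_sqrt_mult)
  finally show ?thesis
    unfolding det by (simp add: negativity_def Z_def concurrence_def f_def[abs_def])
qed

subsection \<open>Convex roofs over unnormalised ensembles\<close>

text \<open>Weights are absorbed into the vectors, so the trace condition replaces the sum of
  probabilities. The index set is any finite set because partial traces and gluing produce products
  and dependent sums.\<close>

definition ensemble :: "nat \<Rightarrow> complex mat \<Rightarrow> 'i set \<Rightarrow> ('i \<Rightarrow> nat \<Rightarrow> complex) \<Rightarrow> bool" where
  "ensemble n \<rho> I v \<longleftrightarrow> finite I \<and> mat_trace \<rho> = 1 \<and>
     \<rho> = mat n n (\<lambda>(r, c). \<Sum>i\<in>I. v i r * cnj (v i c))"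

lemma mat_trace_gram:
  "mat_trace (mat n n (\<lambda>(r, c). \<Sum>i\<in>I. v i r * cnj (v i c))) = of_real (\<Sum>i\<in>I. \<Sum>r<n. (cmod (v i r))\<^sup>2)"
  unfolding of_real_sum of_real_cmod_sq by (subst sum.swap) (simp add: mat_trace_def)

lemma ensemble_norm:
  assumes "ensemble n \<rho> I v"
  shows "(\<Sum>i\<in>I. \<Sum>r<n. (cmod (v i r))\<^sup>2) = 1"
proof -
  have \<rho>: "\<rho> = mat n n (\<lambda>(r, c). \<Sum>i\<in>I. v i r * cnj (v i c))" and tr: "mat_trace \<rho> = 1"
    using assms unfolding ensemble_def by blast+
  show ?thesis using tr by (subst (asm) \<rho>) (simp only: mat_trace_gram of_real_eq_1_iff)
qed

lemma ensemble_transfer: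
  assumes "ensemble n \<rho> I v" and "finite J"
    and "\<And>r c. r < n \<Longrightarrow> c < n \<Longrightarrow> (\<Sum>j\<in>J. w j r * cnj (w j c)) = (\<Sum>i\<in>I. v i r * cnj (v i c))"
  shows "ensemble n \<rho> J w"
  using assms unfolding ensemble_def by (auto intro!: eq_matI)

lemma ensemble_reindex:
  assumes "ensemble n \<rho> I v"
  shows "\<exists>h. bij_betw h {..<card I} I \<and> ensemble n \<rho> {..<card I} (\<lambda>j. v (h j))"
proof -
  have "finite I" using assms by (simp add: ensemble_def)
  then obtain h where h: "bij_betw h {..<card I} I"
    using ex_bij_betw_nat_finite[of I] by (auto simp: atLeast0LessThan)
  have "ensemble n \<rho> {..<card I} (\<lambda>j. v (h j))"
    using assms by (rule ensemble_transfer) (simp_all add: sum.reindex_bij_betw[OF h, of "\<lambda>i. v i _ * cnj (v i _)"])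
  then show ?thesis using h by blast
qed

text \<open>The translation is v = sqrt p times \<psi>; conversely p is the squared norm of
  v.\<close>

lemma cren_eq_Inf_concurrence:
  "cren 2 d \<rho> = Inf {\<Sum>i<n. concurrence d (v i) | n v. ensemble (2 * d) \<rho> {..<n :: nat} v}"
proof -
  have "{\<Sum>i<n. p i * negativity 2 d (projector (\<psi> i)) | n p \<psi>. pure_decomposition (2 * d) \<rho> n p \<psi>}
      = {\<Sum>i<n. concurrence d (v i) | n v. ensemble (2 * d) \<rho> {..<n :: nat} v}" (is "?A = ?B")
  proof (intro equalityI subsetI)
    fix x assume "x \<in> ?A"
    then obtain n p \<psi> where x: "x = (\<Sum>i<n. p i * negativity 2 d (projector (\<psi> i)))"
      and dec: "pure_decomposition (2 * d) \<rho> n p \<psi>" by blast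
    have p0: "0 \<le> p i" and ps: "pure_state (2 * d) (\<psi> i)" if "i < n" for i
      using dec that by (auto simp: pure_decomposition_def)
    define v where "v i r = of_real (sqrt (p i)) * \<psi> i $ r" for i r
    have vv: "v i r * cnj (v i c) = of_real (p i) * projector (\<psi> i) $$ (r, c)"
      if "i < n" "r < 2 * d" "c < 2 * d" for i r c
    proof -
      have "complex_of_real (sqrt (p i)) * complex_of_real (sqrt (p i)) = of_real (p i)"
        using p0[OF that(1)] unfolding of_real_mult[symmetric] by simp
      then have "v i r * cnj (v i c) = of_real (p i) * (\<psi> i $ r * cnj (\<psi> i $ c))"
        by (simp add: v_def)
      moreover have "dim_vec (\<psi> i) = 2 * d" using ps[OF that(1)] by (auto simp: pure_state_def)
      ultimately show ?thesis using that by (simp add: projector_def)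
    qed
    have \<rho>: "\<rho> = mat (2 * d) (2 * d) (\<lambda>(r, c). \<Sum>i<n. v i r * cnj (v i c))"
      using dec by (auto simp: pure_decomposition_def vv intro!: eq_matI)
    have "(\<Sum>r<2 * d. (cmod (v i r))\<^sup>2) = p i" if "i < n" for i
    proof -
      have "complex_of_real (\<Sum>r<2 * d. (cmod (\<psi> i $ r))\<^sup>2) = \<psi> i \<bullet>c \<psi> i"
      proof -
        have "dim_vec (\<psi> i) = 2 * d" using ps[OF that] by (auto simp: pure_state_def)
        then show ?thesis
          unfolding of_real_sum of_real_cmod_sq by (simp add: scalar_prod_def atLeast0LessThan)
      qed
      then have "(\<Sum>r<2 * d. (cmod (\<psi> i $ r))\<^sup>2) = 1"
        using ps[OF that] unfolding pure_state_def by (metis of_real_eq_1_iff)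
      then show ?thesis
        using p0[OF that] by (simp add: v_def norm_mult power_mult_distrib sum_distrib_left[symmetric])
    qed
    then have "(\<Sum>i<n. \<Sum>r<2 * d. (cmod (v i r))\<^sup>2) = 1"
      using dec by (simp add: pure_decomposition_def)
    then have "ensemble (2 * d) \<rho> {..<n} v" by (simp only: ensemble_def \<rho> mat_trace_gram) simp
    moreover have "x = (\<Sum>i<n. concurrence d (v i))"
      unfolding x v_def using p0 ps by (simp add: concurrence_scale negativity_pure)
    ultimately show "x \<in> ?B" by blast
  next
    fix x assume "x \<in> ?B"
    then obtain n :: nat and v where x: "x = (\<Sum>i<n. concurrence d (v i))" and e: "ensemble (2 * d) \<rho> {..<n} v" by blast
    define p where "p i = (\<Sum>r<2 * d. (cmod (v i r))\<^sup>2)" for i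
    have p0: "0 \<le> p i" for i by (simp add: p_def sum_nonneg)
    have p1: "(\<Sum>i<n. p i) = 1" using ensemble_norm[OF e] by (simp add: p_def)
    then have d: "0 < 2 * d" by (cases d) (simp_all add: p_def)
    \<comment> \<open>A zero vector has weight 0, so any unit vector may stand for it.
      \<open>unit_vec\<close> qualifies since the dimension is positive.\<close>
    define \<psi> where "\<psi> i = (if p i = 0 then unit_vec (2 * d) 0 else vec (2 * d) (\<lambda>r. v i r / of_real (sqrt (p i))))" for i
    have v: "v i r = of_real (sqrt (p i)) * \<psi> i $ r" if "r < 2 * d" for i r
    proof (cases "p i = 0")
      case True
      then have "v i r = 0" using that by (simp add: p_def sum_nonneg_eq_0_iff)
      then show ?thesis using True by simp
    next
      case False
      then show ?thesis using that by (simp add: \<psi>_def)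
    qed
    have ps: "pure_state (2 * d) (\<psi> i)" for i
    proof (cases "p i = 0")
      case True
      then show ?thesis using d by (simp add: \<psi>_def pure_state_def)
    next
      case False
      have sq: "complex_of_real (sqrt (p i)) * complex_of_real (sqrt (p i)) = of_real (p i)"
        using p0 unfolding of_real_mult[symmetric] by simp
      have "of_real (p i) = (\<Sum>r<2 * d. v i r * cnj (v i r))"
        by (simp only: p_def of_real_sum of_real_cmod_sq)
      moreover have "\<psi> i \<bullet>c \<psi> i = (\<Sum>r<2 * d. v i r * cnj (v i r)) / of_real (p i)"
        using False sq by (simp add: \<psi>_def scalar_prod_def atLeast0LessThan sum_divide_distrib)
      ultimately have "\<psi> i \<bullet>c \<psi> i = of_real (p i) / of_real (p i)" by (simp only:)
      then have "\<psi> i \<bullet>c \<psi> i = 1" using False by simp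
      moreover have "\<psi> i \<in> carrier_vec (2 * d)" by (simp add: \<psi>_def)
      ultimately show ?thesis unfolding pure_state_def by blast
    qed
    have "pure_decomposition (2 * d) \<rho> n p \<psi>"
      unfolding pure_decomposition_def
    proof (intro conjI allI impI)
      have vv: "v i r * cnj (v i c) = of_real (p i) * projector (\<psi> i) $$ (r, c)"
        if "r < 2 * d" "c < 2 * d" for i r c
      proof -
        have "complex_of_real (sqrt (p i)) * complex_of_real (sqrt (p i)) = of_real (p i)"
          using p0 unfolding of_real_mult[symmetric] by simp
        then have "v i r * cnj (v i c) = of_real (p i) * (\<psi> i $ r * cnj (\<psi> i $ c))"
          using that by (simp add: v)
        moreover have "dim_vec (\<psi> i) = 2 * d" using ps[of i] by (auto simp: pure_state_def)
        ultimately show ?thesis using that by (simp add: projector_def)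
      qed
      show "\<rho> = mat (2 * d) (2 * d) (\<lambda>(r, c). \<Sum>i<n. of_real (p i) * projector (\<psi> i) $$ (r, c))"
        using e by (auto simp: ensemble_def vv intro!: eq_matI)
    qed (use p0 p1 ps in auto)
    moreover have "concurrence d (v i) = p i * negativity 2 d (projector (\<psi> i))" for i
    proof -
      have "concurrence d (v i) = concurrence d (\<lambda>r. of_real (sqrt (p i)) * \<psi> i $ r)"
        by (rule concurrence_cong) (simp add: v)
      then show ?thesis using p0 by (simp add: concurrence_scale negativity_pure[OF ps])
    qed
    ultimately show "x \<in> ?A" unfolding x by (intro CollectI exI[of _ n] exI[of _ p] exI[of _ \<psi>]) simp
  qed
  then show ?thesis by (simp add: cren_def)
qed

lemma cren_le_ensemble:
  assumes "ensemble (2 * d) \<rho> I v"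
  shows "cren 2 d \<rho> \<le> (\<Sum>i\<in>I. concurrence d (v i))"
proof -
  obtain h where h: "bij_betw h {..<card I} I" "ensemble (2 * d) \<rho> {..<card I} (\<lambda>j. v (h j))"
    using ensemble_reindex[OF assms] by blast
  have "cren 2 d \<rho> \<le> (\<Sum>i<card I. concurrence d (v (h i)))"
    unfolding cren_eq_Inf_concurrence
    by (rule cInf_lower) (use h in \<open>auto intro!: bdd_belowI[of _ 0] sum_nonneg concurrence_nonneg\<close>)
  also have "\<dots> = (\<Sum>i\<in>I. concurrence d (v i))" by (rule sum.reindex_bij_betw[OF h(1)])
  finally show ?thesis .
qed

text \<open>The first assumption ensures that the infimum is taken over a nonempty set.\<close>

lemma le_cren_ensemble:
  assumes "ensemble (2 * d) \<rho> I v"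
    and "\<And>n v. ensemble (2 * d) \<rho> {..<n :: nat} v \<Longrightarrow> b \<le> (\<Sum>i<n. concurrence d (v i))"
  shows "b \<le> cren 2 d \<rho>"
  unfolding cren_eq_Inf_concurrence
proof (rule cInf_greatest)
  show "{\<Sum>i<n. concurrence d (v i) | n v. ensemble (2 * d) \<rho> {..<n :: nat} v} \<noteq> {}"
    using ensemble_reindex[OF assms(1)] by blast
qed (use assms(2) in auto)

lemma cren_nonneg: "ensemble (2 * d) \<rho> I v \<Longrightarrow> 0 \<le> cren 2 d \<rho>"
  by (rule le_cren_ensemble) (auto intro: sum_nonneg concurrence_nonneg)

section \<open>Ensembles of reduced states\<close>

lemma digits_less:
  fixes x y b :: nat
  assumes "x < a" "y < b"
  shows "x * b + y < a * b"
proof -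
  have "x * b + y < x * b + b" using assms by simp
  also have "\<dots> = (x + 1) * b" by simp
  also have "\<dots> \<le> a * b" using assms by (intro mult_right_mono) auto
  finally show ?thesis .
qed

lemma digits_div_mod:
  fixes x y b :: nat
  assumes "y < b"
  shows "(x * b + y) div b = x" "(x * b + y) mod b = y"
  using assms by simp_all

text \<open>Tracing out a factor amounts to measuring it in its basis and forgetting the outcome, so
  the slices of the old vectors form the new ensemble.\<close>

lemma ensemble_partial_trace:
  assumes "ensemble (dA * (dB * dC)) \<rho> I v"
  shows "ensemble (dA * dC) (partial_trace dA dB dC \<rho>) (I \<times> {..<dB})
    (\<lambda>(i, b) r. v i ((r div dC) * (dB * dC) + b * dC + r mod dC))"
proof -
  define w where "w = (\<lambda>(i, b) r. v i ((r div dC) * (dB * dC) + b * dC + r mod dC))"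
  have fin: "finite I" and \<rho>: "\<rho> = mat (dA * (dB * dC)) (dA * (dB * dC)) (\<lambda>(r, c). \<Sum>i\<in>I. v i r * cnj (v i c))"
    using assms by (simp_all add: ensemble_def)
  have eq: "partial_trace dA dB dC \<rho> = mat (dA * dC) (dA * dC) (\<lambda>(r, c). \<Sum>i\<in>I \<times> {..<dB}. w i r * cnj (w i c))"
  proof (rule eq_matI)
    fix r c
    assume "r < dim_row (mat (dA * dC) (dA * dC) (\<lambda>(r, c). \<Sum>i\<in>I \<times> {..<dB}. w i r * cnj (w i c)))"
      "c < dim_col (mat (dA * dC) (dA * dC) (\<lambda>(r, c). \<Sum>i\<in>I \<times> {..<dB}. w i r * cnj (w i c)))"
    then have rc: "r < dA * dC" "c < dA * dC" by simp_all
    then have "0 < dC" by (cases dC) auto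
    then have ix: "(r div dC) * (dB * dC) + b * dC + r mod dC < dA * (dB * dC)" if "b < dB" "r < dA * dC" for b r
      using that by (simp add: add.assoc digits_less less_mult_imp_div_less)
    have "partial_trace dA dB dC \<rho> $$ (r, c) = (\<Sum>b<dB. \<Sum>i\<in>I. w (i, b) r * cnj (w (i, b) c))"
      using rc by (simp add: partial_trace_def \<rho> ix w_def)
    also have "\<dots> = (\<Sum>i\<in>I \<times> {..<dB}. w i r * cnj (w i c))"
      by (subst sum.swap) (simp add: sum.cartesian_product split_def)
    finally show "partial_trace dA dB dC \<rho> $$ (r, c) =
      mat (dA * dC) (dA * dC) (\<lambda>(r, c). \<Sum>i\<in>I \<times> {..<dB}. w i r * cnj (w i c)) $$ (r, c)"
      using rc by simp
  qed (simp_all add: partial_trace_def)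
  have "(\<Sum>i\<in>I \<times> {..<dB}. \<Sum>r<dA * dC. (cmod (w i r))\<^sup>2)
      = (\<Sum>i\<in>I. \<Sum>b<dB. \<Sum>x<dA. \<Sum>y<dC. (cmod (v i (x * (dB * dC) + (b * dC + y))))\<^sup>2)"
    unfolding sum.cartesian_product' sum_lessThan_mult
    by (intro sum.cong refl) (simp add: w_def add.assoc)
  also have "\<dots> = (\<Sum>i\<in>I. \<Sum>x<dA. \<Sum>b<dB. \<Sum>y<dC. (cmod (v i (x * (dB * dC) + (b * dC + y))))\<^sup>2)"
    by (intro sum.cong[OF refl]) (rule sum.swap)
  also have "\<dots> = (\<Sum>i\<in>I. \<Sum>r<dA * (dB * dC). (cmod (v i r))\<^sup>2)"
    by (simp only: sum_lessThan_mult)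
  also have "\<dots> = 1" by (rule ensemble_norm[OF assms])
  finally have "mat_trace (partial_trace dA dB dC \<rho>) = 1" unfolding eq mat_trace_gram by simp
  then show ?thesis using fin eq unfolding ensemble_def w_def by simp
qed

lemma ensemble_density_matrix:
  assumes "density_matrix n \<rho>"
  shows "\<exists>v. ensemble n \<rho> {..<n} v"
proof -
  have "\<rho> \<in> carrier_mat n n" "mat_trace \<rho> = 1" "nonneg_form n (\<lambda>r c. \<rho> $$ (r, c))"
    using assms by (auto simp: density_matrix_def psd_iff_nonneg_form)
  then show ?thesis
    using nonneg_form_gram_decomposition[of n "\<lambda>r c. \<rho> $$ (r, c)"]
    by (auto simp: ensemble_def intro!: eq_matI)
qed

lemma sum_squares_le_square_sum:
  fixes a b c :: "'i \<Rightarrow> real"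
  assumes "\<And>i. i \<in> I \<Longrightarrow> (a i)\<^sup>2 + (b i)\<^sup>2 \<le> (c i)\<^sup>2" "\<And>i. i \<in> I \<Longrightarrow> 0 \<le> c i"
  shows "(\<Sum>i\<in>I. a i)\<^sup>2 + (\<Sum>i\<in>I. b i)\<^sup>2 \<le> (\<Sum>i\<in>I. c i)\<^sup>2"
proof -
  have S: "(\<Sum>i\<in>I. Complex (a i) (b i)) = Complex (\<Sum>i\<in>I. a i) (\<Sum>i\<in>I. b i)"
    by (simp add: complex_eq_iff)
  have "cmod (Complex (a i) (b i)) \<le> c i" if "i \<in> I" for i
    using assms[OF that] by (simp add: cmod_def real_le_lsqrt)
  then have "cmod (\<Sum>i\<in>I. Complex (a i) (b i)) \<le> (\<Sum>i\<in>I. c i)"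
    by (intro order.trans[OF norm_sum] sum_mono)
  then have "(cmod (\<Sum>i\<in>I. Complex (a i) (b i)))\<^sup>2 \<le> (\<Sum>i\<in>I. c i)\<^sup>2"
    by (intro power_mono) auto
  then show ?thesis unfolding S by (simp add: cmod_power2)
qed

lemma concurrence_2: "concurrence 2 v = 2 * cmod (det2 v)"
proof -
  have "complex_of_real (gram_det {..<2} v (\<lambda>y. v (2 + y))) = of_real ((cmod (det2 v))\<^sup>2)"
    unfolding of_real_gram_det of_real_cmod_sq sum_lessThan_2 by (simp add: det2_def Suc_numerals algebra_simps)
  then have "gram_det {..<2} v (\<lambda>y. v (2 + y)) = (cmod (det2 v))\<^sup>2" by (simp only: of_real_eq_iff)
  then show ?thesis by (simp add: concurrence_def)
qed

subsection \<open>Monogamy\<close>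

lemma cren_monogamy:
  assumes \<rho>: "ensemble (2 * (2 * d)) \<rho> I0 v0"
  shows "(cren 2 2 (partial_trace (2 * 2) d 1 \<rho>))\<^sup>2 + (cren 2 d (partial_trace 2 2 d \<rho>))\<^sup>2
    \<le> (cren 2 (2 * d) \<rho>)\<^sup>2"
proof -
  define s where "s = cren 2 2 (partial_trace (2 * 2) d 1 \<rho>)"
  define t where "t = cren 2 d (partial_trace 2 2 d \<rho>)"
  have ab: "ensemble (2 * 2) (partial_trace (2 * 2) d 1 \<rho>) (I \<times> {..<d}) (\<lambda>(i, c) r. v i (r * d + c))"
    if "ensemble (2 * (2 * d)) \<rho> I v" for v and I :: "'x set"
    using ensemble_partial_trace[of "2 * 2" d 1 \<rho> I v] that by (simp add: mult.assoc)
  have ac: "ensemble (2 * d) (partial_trace 2 2 d \<rho>) (I \<times> {..<2}) (\<lambda>(i, b) r. v i (r div d * (2 * d) + b * d + r mod d))"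
    if "ensemble (2 * (2 * d)) \<rho> I v" for v and I :: "'x set"
    using ensemble_partial_trace[of 2 2 d \<rho> I v] that by simp
  have s0: "0 \<le> s" and t0: "0 \<le> t"
    unfolding s_def t_def using cren_nonneg ab[OF \<rho>] ac[OF \<rho>] by blast+
  have "sqrt (s\<^sup>2 + t\<^sup>2) \<le> cren 2 (2 * d) \<rho>"
  proof (rule le_cren_ensemble[OF \<rho>])
    fix n :: nat and v
    assume e: "ensemble (2 * (2 * d)) \<rho> {..<n} v"
    define w where "w j c r = v j (r * d + c)" for j c r
    \<comment> \<open>The body of \<open>pure_monogamy\<close> with its witnesses as parameters, so
      that they can be chosen as functions of \<open>j\<close>.\<close>
    define Q where "Q j m e u \<longleftrightarrow>
     (\<forall>r<4. \<forall>s<4. (\<Sum>i<m. e i r * cnj (e i s)) = (\<Sum>c<d. w j c r * cnj (w j c s))) \<and>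
     (\<forall>a<2. \<forall>b<2. (\<Sum>i<2::nat. u i a * cnj (u i b)) = (if a = b then 1 else 0)) \<and>
     (\<Sum>i<m. cmod (det2 (e i)))\<^sup>2
     + (\<Sum>i<2. sqrt (gram_det {..<d} (\<lambda>c. u i 0 * w j c 0 + u i 1 * w j c 1) (\<lambda>c. u i 0 * w j c 2 + u i 1 * w j c 3)))\<^sup>2
     \<le> gram_det ({..<2::nat} \<times> {..<d}) (\<lambda>(b, c). w j c b) (\<lambda>(b, c). w j c (2 + b))"
      for j and m :: nat and e and u :: "nat \<Rightarrow> nat \<Rightarrow> complex"
    have "\<exists>m e u. Q j m e u" for j
      using pure_monogamy_all[of d "w j"] unfolding pure_monogamy_def Q_def .
    then obtain m e' u where Q: "\<And>j. Q j (m j) (e' j) (u j)" by metis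
    have gram: "(\<Sum>i<m j. e' j i r * cnj (e' j i s)) = (\<Sum>c<d. w j c r * cnj (w j c s))" if "r < 4" "s < 4" for j r s
      using Q[of j] that unfolding Q_def by blast
    have unitary: "(\<Sum>i<2. u j i a * cnj (u j i b)) = (if a = b then 1 else 0)" if "a < 2" "b < 2" for j a b
      using Q[of j] that unfolding Q_def by blast
    define A where "A j = (\<Sum>i<m j. concurrence 2 (e' j i))" for j
    \<comment> \<open>The unnormalised state of \<open>AC\<close> after outcome \<open>i\<close> of
      measuring \<open>B\<close> in the basis chosen for the j-th vector.\<close>
    define y where "y = (\<lambda>(j, i) r. \<Sum>b<2. u j i b * v j (r div d * (2 * d) + b * d + r mod d))"
    define B where "B j = (\<Sum>i<2. concurrence d (y (j, i)))" for j
    have le: "(A j)\<^sup>2 + (B j)\<^sup>2 \<le> (concurrence (2 * d) (v j))\<^sup>2" for j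
    proof -
      have A: "A j = 2 * (\<Sum>i<m j. cmod (det2 (e' j i)))" by (simp add: A_def concurrence_2 sum_distrib_left)
      have "gram_det {..<d} (y (j, i)) (\<lambda>c. y (j, i) (d + c)) =
        gram_det {..<d} (\<lambda>c. u j i 0 * w j c 0 + u j i 1 * w j c 1) (\<lambda>c. u j i 0 * w j c 2 + u j i 1 * w j c 3)" for i
      proof -
        have "y (j, i) c = u j i 0 * w j c 0 + u j i 1 * w j c 1"
          "y (j, i) (d + c) = u j i 0 * w j c 2 + u j i 1 * w j c 3" if "c < d" for c
          using that by (simp_all add: y_def sum_lessThan_2 w_def)
        then show ?thesis by (simp add: gram_det_def)
      qed
      then have B: "B j = 2 * (\<Sum>i<2. sqrt (gram_det {..<d} (\<lambda>c. u j i 0 * w j c 0 + u j i 1 * w j c 1)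
          (\<lambda>c. u j i 0 * w j c 2 + u j i 1 * w j c 3)))"
        by (simp add: B_def concurrence_def sum_distrib_left)
      have G: "gram_det ({..<2::nat} \<times> {..<d}) (\<lambda>(b, c). w j c b) (\<lambda>(b, c). w j c (2 + b))
          = gram_det {..<2 * d} (v j) (\<lambda>i. v j (2 * d + i))"
      proof -
        have 1: "v j (x * d + c) = w j c x" and 2: "v j (2 * d + (x * d + c)) = w j c (2 + x)" for x c
          by (simp_all only: w_def add_mult_distrib add.assoc)
        show ?thesis
          unfolding gram_det_def sum_lessThan_mult unfolding 2 unfolding 1
          by (simp add: sum_lessThan_2_times sum_lessThan_2 sum.distrib)
      qed
      have "(concurrence (2 * d) (v j))\<^sup>2 = 4 * gram_det {..<2 * d} (v j) (\<lambda>i. v j (2 * d + i))"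
        by (simp add: concurrence_def power_mult_distrib gram_det_nonneg)
      then show ?thesis using Q[of j] unfolding Q_def G A B power_mult_distrib by simp
    qed
    have "s \<le> (\<Sum>(j, i)\<in>(SIGMA j:{..<n}. {..<m j}). concurrence 2 (e' j i))"
    proof -
      have "ensemble (2 * 2) (partial_trace (2 * 2) d 1 \<rho>) (SIGMA j:{..<n}. {..<m j}) (\<lambda>(j, i). e' j i)"
      proof (rule ensemble_transfer[OF ab[OF e]])
        fix r c :: nat assume "r < 2 * 2" "c < 2 * 2"
        then have "(\<Sum>j<n. \<Sum>i<m j. e' j i r * cnj (e' j i c)) = (\<Sum>j<n. \<Sum>y<d. w j y r * cnj (w j y c))"
          using gram by simp
        moreover have Sig: "(\<Sum>p\<in>(SIGMA j:{..<n}. {..<m j}). e' (fst p) (snd p) r * cnj (e' (fst p) (snd p) c))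
            = (\<Sum>j<n. \<Sum>i<m j. e' j i r * cnj (e' j i c))"
          by (subst sum.Sigma) (simp_all add: split_def)
        ultimately show "(\<Sum>j\<in>(SIGMA j:{..<n}. {..<m j}). (case j of (j, i) \<Rightarrow> e' j i) r * cnj ((case j of (j, i) \<Rightarrow> e' j i) c)) =
          (\<Sum>i\<in>{..<n} \<times> {..<d}. (case i of (i, c) \<Rightarrow> \<lambda>r. v i (r * d + c)) r * cnj ((case i of (i, c) \<Rightarrow> \<lambda>r. v i (r * d + c)) c))"
          by (simp add: split_def sum.cartesian_product' w_def Sig)
      qed simp
      from cren_le_ensemble[OF this] show ?thesis by (simp add: s_def split_def)
    qed
    also have "\<dots> = (\<Sum>j<n. A j)" by (simp add: A_def sum.Sigma)
    finally have sA: "s \<le> (\<Sum>j<n. A j)" .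
    have "t \<le> (\<Sum>i\<in>{..<n} \<times> {..<2}. concurrence d (y i))"
    proof -
      have "ensemble (2 * d) (partial_trace 2 2 d \<rho>) ({..<n} \<times> {..<2}) y"
      proof (rule ensemble_transfer[OF ac[OF e]])
        fix r c assume "r < 2 * d" "c < 2 * d"
        define f where "f j b r = v j (r div d * (2 * d) + b * d + r mod d)" for j b r
        have "(\<Sum>i<2. y (j, i) r * cnj (y (j, i) c)) = (\<Sum>b<2. f j b r * cnj (f j b c))" for j
        proof -
          have "(\<Sum>i<2. y (j, i) r * cnj (y (j, i) c)) =
            (\<Sum>i<2. \<Sum>a<2. \<Sum>b<2. f j a r * cnj (f j b c) * (u j i a * cnj (u j i b)))"
            by (simp add: y_def f_def sum_product mult_ac)
          also have "\<dots> = (\<Sum>a<2. \<Sum>b<2. \<Sum>i<2. f j a r * cnj (f j b c) * (u j i a * cnj (u j i b)))"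
            by (subst sum.swap, rule sum.cong[OF refl], rule sum.swap)
          also have "\<dots> = (\<Sum>a<2. \<Sum>b<2. if a = b then f j a r * cnj (f j b c) else 0)"
            unfolding sum_distrib_left[symmetric] by (intro sum.cong refl) (simp add: unitary)
          finally show ?thesis by simp
        qed
        then show "(\<Sum>i\<in>{..<n} \<times> {..<2}. y i r * cnj (y i c)) =
          (\<Sum>i\<in>{..<n} \<times> {..<2}. (case i of (i, b) \<Rightarrow> \<lambda>r. v i (r div d * (2 * d) + b * d + r mod d)) r *
            cnj ((case i of (i, b) \<Rightarrow> \<lambda>r. v i (r div d * (2 * d) + b * d + r mod d)) c))"
          by (simp add: split_def sum.cartesian_product' f_def)
      qed simp
      from cren_le_ensemble[OF this] show ?thesis by (simp add: t_def)
    qed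
    also have "\<dots> = (\<Sum>j<n. B j)" by (simp add: B_def sum.cartesian_product')
    finally have tB: "t \<le> (\<Sum>j<n. B j)" .
    have "s\<^sup>2 + t\<^sup>2 \<le> (\<Sum>j<n. A j)\<^sup>2 + (\<Sum>j<n. B j)\<^sup>2"
      using sA tB s0 t0 by (intro add_mono power_mono)
    also have "\<dots> \<le> (\<Sum>j<n. concurrence (2 * d) (v j))\<^sup>2"
      by (rule sum_squares_le_square_sum) (auto intro: le concurrence_nonneg)
    finally show "sqrt (s\<^sup>2 + t\<^sup>2) \<le> (\<Sum>j<n. concurrence (2 * d) (v j))"
      by (intro real_le_lsqrt sum_nonneg concurrence_nonneg) auto
  qed
  then have "(sqrt (s\<^sup>2 + t\<^sup>2))\<^sup>2 \<le> (cren 2 (2 * d) \<rho>)\<^sup>2" by (intro power_mono) auto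
  then show ?thesis by (simp add: s_def t_def)
qed

section \<open>Successive partial traces and the weighted inequality\<close>

lemma partial_trace_1_1:
  "A \<in> carrier_mat n n \<Longrightarrow> partial_trace n 1 1 A = A"
  by (auto simp: partial_trace_def intro!: eq_matI)

text \<open>The two traced indices x and y merge into the single index x dB + y. This links the
  successive tails of the qubit chain.\<close>

lemma partial_trace_partial_trace:
  "partial_trace dA dB dC (partial_trace dA b (dB * dC) \<rho>) = partial_trace dA (b * dB) dC \<rho>"
proof (rule eq_matI)
  fix r c assume "r < dim_row (partial_trace dA (b * dB) dC \<rho>)" "c < dim_col (partial_trace dA (b * dB) dC \<rho>)"
  then have rc: "r < dA * dC" "c < dA * dC" by (simp_all add: partial_trace_def)
  then have dC: "0 < dC" by (cases dC) auto
  have dv: "((r div dC) * (dB * dC) + y * dC + r mod dC) div (dB * dC) = r div dC"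
    "((r div dC) * (dB * dC) + y * dC + r mod dC) mod (dB * dC) = y * dC + r mod dC"
    "(r div dC) * (dB * dC) + y * dC + r mod dC < dA * (dB * dC)"
    if "y < dB" "r < dA * dC" for r y
  proof -
    have "y * dC + r mod dC < dB * dC" using that dC by (intro digits_less) auto
    then show "((r div dC) * (dB * dC) + y * dC + r mod dC) div (dB * dC) = r div dC"
      "((r div dC) * (dB * dC) + y * dC + r mod dC) mod (dB * dC) = y * dC + r mod dC"
      "(r div dC) * (dB * dC) + y * dC + r mod dC < dA * (dB * dC)"
      using that by (simp_all only: add.assoc digits_div_mod digits_less less_mult_imp_div_less)
  qed
  have "partial_trace dA dB dC (partial_trace dA b (dB * dC) \<rho>) $$ (r, c) =
    (\<Sum>y<dB. \<Sum>x<b. \<rho> $$ ((r div dC) * (b * (dB * dC)) + x * (dB * dC) + (y * dC + r mod dC),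
      (c div dC) * (b * (dB * dC)) + x * (dB * dC) + (y * dC + c mod dC)))"
    using rc dv by (simp add: partial_trace_def)
  also have "\<dots> = partial_trace dA (b * dB) dC \<rho> $$ (r, c)"
    using rc by (subst sum.swap) (simp add: partial_trace_def sum_lessThan_mult algebra_simps)
  finally show "partial_trace dA dB dC (partial_trace dA b (dB * dC) \<rho>) $$ (r, c) =
    partial_trace dA (b * dB) dC \<rho> $$ (r, c)" .
qed (simp_all add: partial_trace_def)

theorem theorem3:
  fixes k \<beta> :: real and N m :: nat and \<rho> :: "complex mat"
  assumes "0 < k" and "k \<le> 1"
    and "N \<ge> 4" and "1 \<le> m" and "m \<le> N - 3"
    and "density_matrix (2 ^ N) \<rho>"
    and "\<And>i. i \<in> {1..m} \<Longrightarrow> k * (cren_pair N \<rho> i)\<^sup>2 \<ge> (cren_tail N \<rho> (i + 1))\<^sup>2"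
    and "\<And>j. j \<in> {m+1..N-2} \<Longrightarrow> (cren_pair N \<rho> j)\<^sup>2 \<le> k * (cren_tail N \<rho> (j + 1))\<^sup>2"
    and "\<beta> \<ge> 4"
  shows "cren_tail N \<rho> 1 powr \<beta> \<ge>
      cren_pair N \<rho> 1 powr \<beta>
    + (\<Sum>i=1..m-1. (\<Prod>j=1..i. coeff_P k \<beta> N \<rho> j) * cren_pair N \<rho> (i + 1) powr \<beta>)
    + (\<Prod>i=1..m. coeff_P k \<beta> N \<rho> i)
      * ((\<Sum>j=m+1..N-2. coeff_R k \<beta> N \<rho> j * cren_pair N \<rho> j powr \<beta>)
         + cren_pair N \<rho> (N - 1) powr \<beta>)"
proof -
  define \<sigma> where "\<sigma> i = partial_trace 2 (2 ^ (i - 1)) (2 ^ (N - i)) \<rho>" for i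
  obtain v where v: "ensemble (2 ^ N) \<rho> {..<2 ^ N :: nat} v"
    using ensemble_density_matrix[OF assms(6)] by blast
  have \<sigma>: "\<exists>(I :: (nat \<times> nat) set) w. ensemble (2 * 2 ^ (N - i)) (\<sigma> i) I w" if "1 \<le> i" "i \<le> N - 1" for i
  proof -
    have "2 ^ N = (2::nat) ^ (1 + (i - 1) + (N - i))" using that by simp
    also have "\<dots> = 2 * (2 ^ (i - 1) * 2 ^ (N - i))" by (simp only: power_add) simp
    finally have e: "2 ^ N = (2::nat) * (2 ^ (i - 1) * 2 ^ (N - i))" .
    show ?thesis unfolding \<sigma>_def using ensemble_partial_trace[OF v[unfolded e]] by blast
  qed
  have tail: "cren_tail N \<rho> i = cren 2 (2 ^ (N - i)) (\<sigma> i)" if "1 \<le> i" "i \<le> N - 1" for i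
  proof -
    have "\<sigma> i \<in> carrier_mat (2 * 2 ^ (N - i)) (2 * 2 ^ (N - i))" by (simp add: \<sigma>_def partial_trace_def)
    moreover have "N - 1 + 1 - i = N - i" using that by simp
    ultimately show ?thesis
      using partial_trace_1_1 by (simp add: cren_tail_def reduced_state_def \<sigma>_def)
  qed
  have pair: "cren_pair N \<rho> i = cren 2 2 (partial_trace (2 * 2) (2 ^ (N - 1 - i)) 1 (\<sigma> i))" for i
    by (simp add: cren_pair_def reduced_state_def \<sigma>_def)
  have nn: "0 \<le> cren_pair N \<rho> i \<and> 0 \<le> cren_tail N \<rho> i" if i: "1 \<le> i" "i \<le> N - 1" for i
  proof -
    obtain I :: "(nat \<times> nat) set" and w where w: "ensemble (2 * 2 ^ (N - i)) (\<sigma> i) I w"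
      using \<sigma>[OF i] by blast
    have "N - i = Suc (N - 1 - i)" using i assms(3) by simp
    then have "2 * 2 ^ (N - i) = (2 * 2) * (2 ^ (N - 1 - i) * (1::nat))" by simp
    from ensemble_partial_trace[OF w[unfolded this]] cren_nonneg[OF w] show ?thesis
      unfolding tail[OF i] pair by (auto intro!: cren_nonneg)
  qed
  have mono: "(cren_pair N \<rho> i)\<^sup>2 + (cren_tail N \<rho> (i + 1))\<^sup>2 \<le> (cren_tail N \<rho> i)\<^sup>2"
    if i: "1 \<le> i" "i < N - 1" for i
  proof -
    define d where "d = (2::nat) ^ (N - 1 - i)"
    have "N - i = Suc (N - 1 - i)" using i by simp
    then have d: "2 ^ (N - i) = 2 * d" by (simp add: d_def)
    obtain I :: "(nat \<times> nat) set" and w where w: "ensemble (2 * 2 ^ (N - i)) (\<sigma> i) I w"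
      using \<sigma>[of i] i by auto
    \<comment> \<open>Tracing the next qubit out of one tail gives the next tail, so
      \<open>cren_monogamy\<close> applies with B_i as \<open>B\<close> and the remaining qubits as
      \<open>C\<close>.\<close>
    have "\<sigma> (i + 1) = partial_trace 2 2 d (\<sigma> i)"
    proof -
      have "2 ^ (i - 1) * 2 = (2::nat) ^ i" using i by (cases i) simp_all
      then show ?thesis
        unfolding \<sigma>_def d partial_trace_partial_trace by (simp add: d_def)
    qed
    then have t1: "cren_tail N \<rho> (i + 1) = cren 2 d (partial_trace 2 2 d (\<sigma> i))"
      using tail[of "i + 1"] i by (simp add: d_def)
    have t0: "cren_tail N \<rho> i = cren 2 (2 * d) (\<sigma> i)" using tail[of i] i d by simp
    show ?thesis
      unfolding t0 t1 pair d_def[symmetric] using w unfolding d by (rule cren_monogamy)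
  qed
  have last: "cren_tail N \<rho> (N - 1) = cren_pair N \<rho> (N - 1)"
    using assms(3) by (simp add: cren_tail_def cren_pair_def)
  have rear: "(cren_pair N \<rho> j)\<^sup>2 \<le> k * (cren_tail N \<rho> (j + 1))\<^sup>2" if "j \<in> {m+1..N-1-1}" for j
    using assms(8)[of j] that by (simp add: numeral_2_eq_2)
  have P: "coeff_P k \<beta> N \<rho> i = ((1 + k) powr (\<beta> / 2) - 1) / k powr (\<beta> / 2) + k powr (\<beta> / 2)
      - cren_tail N \<rho> (i + 1) powr \<beta> / cren_pair N \<rho> i powr \<beta>" for i
    by (simp only: coeff_P_def coeff_M_def)
  have R: "coeff_R k \<beta> N \<rho> i = ((1 + k) powr (\<beta> / 2) - 1) / k powr (\<beta> / 2) + k powr (\<beta> / 2)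
      - cren_pair N \<rho> i powr \<beta> / cren_tail N \<rho> (i + 1) powr \<beta>" for i
    by (simp only: coeff_R_def coeff_M_def)
  have m: "m < N - 1" and N: "N - 1 - 1 = N - 2" using assms(3,5) by simp_all
  show ?thesis
    using monogamy_power_chain[OF assms(1,2,9,4) m nn mono last assms(7) rear P R] by (simp only: N)
qed

end
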